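(* Let $b\ge a\ge 1$ be integers. Then, as $n\to\infty$, $$Rt_5(K_{a,b};K_n)=\begin{cases}\displaystyle\left(\frac{1}{5a+b}+o(1)\right)n, & b\le 3a,\\[2ex] \displaystyle\left(\frac{2}{7a+3b}+o(1)\right)n, & 3a\le b\le 5a,\\[2ex] \displaystyle\left(\frac{3}{8a+5b}+o(1)\right)n, & 5a\le b\le\frac{13}{2}a,\\[2ex] \displaystyle\left(\frac{5}{9(a+b)}+o(1)\right)n, & b\ge\frac{13}{2}a.\end{cases}$$
   Context: $K_{a,b}$ is the complete bipartite graph with classes of sizes $a$ and $b$. For an edge-colouring $\chi:E(K_n)\to[r]$ and a graph $H$, let $\nu_H(\chi)$ be the maximum over colours $\ell\in[r]$ of the maximum number of vertex-disjoint copies of $H$ all of whose edges have colour $\ell$. Then $Rt_r(H;K_n):=\min_{\chi:E(K_n)\to[r]}\nu_H(\chi)$. *)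

theory Defs
  imports Complex_Main "HOL-Library.FuncSet" "HOL-Library.Landau_Symbols"
begin

text \<open>A graph is a pair of a vertex set and a set of edges, each edge being a two-element
  set of vertices.\<close>

type_synonym 'v graph = "'v set \<times> 'v set set"

abbreviation verts :: "'v graph \<Rightarrow> 'v set" where
  "verts G \<equiv> fst G"

abbreviation edges :: "'v graph \<Rightarrow> 'v set set" where
  "edges G \<equiv> snd G"

definition complete_graph :: "nat \<Rightarrow> nat graph" where
  "complete_graph n = ({..<n}, {e. e \<subseteq> {..<n} \<and> card e = 2})"

definition complete_bipartite_graph :: "nat \<Rightarrow> nat \<Rightarrow> (nat + nat) graph" where
  "complete_bipartite_graph a b = ({..<a} <+> {..<b}, {{Inl i, Inr j} |i j. i < a \<and> j < b})"

definition graph_iso :: "'u graph \<Rightarrow> 'v graph \<Rightarrow> bool" where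
  "graph_iso H F \<longleftrightarrow>
     (\<exists>f. bij_betw f (verts H) (verts F) \<and> edges F = (\<lambda>e. f ` e) ` edges H)"

definition subgraph :: "'v graph \<Rightarrow> 'v graph \<Rightarrow> bool" where
  "subgraph F G \<longleftrightarrow> verts F \<subseteq> verts G \<and> edges F \<subseteq> edges G"

text \<open>The copies of \<open>H\<close> in \<open>G\<close> are the subgraphs, not necessarily induced, that are
  isomorphic to \<open>H\<close>.\<close>

definition mono_copies ::
    "'u graph \<Rightarrow> 'v graph \<Rightarrow> ('v set \<Rightarrow> nat) \<Rightarrow> nat \<Rightarrow> 'v graph set" where
  "mono_copies H G \<chi> l = {F. subgraph F G \<and> graph_iso H F \<and> (\<forall>e\<in>edges F. \<chi> e = l)}"

definition mono_packings ::
    "'u graph \<Rightarrow> 'v graph \<Rightarrow> ('v set \<Rightarrow> nat) \<Rightarrow> nat \<Rightarrow> 'v graph set set" where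
  "mono_packings H G \<chi> l =
     {P. P \<subseteq> mono_copies H G \<chi> l \<and> pairwise (\<lambda>F F'. verts F \<inter> verts F' = {}) P}"

text \<open>For finite \<open>G\<close> there are finitely many subgraphs, and the empty packing is always
  available, so for \<open>r \<ge> 1\<close> both maxima range over finite nonempty sets.\<close>

definition tiling_number :: "nat \<Rightarrow> 'u graph \<Rightarrow> 'v graph \<Rightarrow> ('v set \<Rightarrow> nat) \<Rightarrow> nat" where
  "tiling_number r H G \<chi> = Max ((\<lambda>l. Max (card ` mono_packings H G \<chi> l)) ` {1..r})"

text \<open>Colourings are extensional functions on the edge set, so that there are finitely many
  of them and the minimum is meaningful.\<close>

definition Rt :: "nat \<Rightarrow> 'u graph \<Rightarrow> 'v graph \<Rightarrow> nat" where
  "Rt r H G = Min (tiling_number r H G ` (edges G \<rightarrow>\<^sub>E {1..r}))"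

end

theory Submission
  imports Defs "HOL-Analysis.Henstock_Kurzweil_Integration"
begin

text \<open>
  Let \<open>D\<close> be the largest of \<open>5a+b\<close>, \<open>(7a+3b)/2\<close>, \<open>(8a+5b)/3\<close> and \<open>9(a+b)/5\<close>. The proof shows that
  \<open>Rt\<close> is \<open>n/D + o(n)\<close>; which of the four forms is the largest depends on \<open>b/a\<close>, and this gives the
  four ranges.

  What bounds a tiling in one colour is a pair of vertex sets \<open>A\<close>, \<open>B\<close> such that every edge of the
  colour meets \<open>A\<close> or lies inside \<open>B\<close>. Give a vertex weight \<open>1/a\<close> for being in \<open>A\<close> and \<open>1/(a+b)\<close> for
  being in \<open>B\<close>. A copy of \<open>K\<^bsub>a,b\<^esub>\<close> in this colour has total weight at least 1, because it has at least
  \<open>a\<close> vertices in \<open>A\<close> or all its vertices in \<open>A \<union> B\<close>. So at most \<open>|A|/a + |B|/(a+b)\<close> copies are disjoint.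
  Suppose that all five colours are covered like this by \<open>A\<^sub>l\<close>, \<open>B\<^sub>l\<close>. To a vertex in no \<open>A\<^sub>l\<close> assign the
  set of all \<open>l\<close> with the vertex in \<open>B\<^sub>l\<close>. Since every edge has a colour, any two of these sets
  intersect, and conversely every assignment of pairwise intersecting sets comes from a colouring.
  The extremal problem is therefore a weighted problem on intersecting families of subsets of five
  points.

  For the upper bound, four families are used: \<open>{1}\<close>; then \<open>12, 13, 23\<close>; then \<open>12, 13, 14, 234\<close>; then
  \<open>12, 13, 145, 234, 235\<close>. A colour that occurs in no member of the family gets its own set \<open>A\<^sub>l\<close>. The
  sizes are chosen so that all five colours cost the same (\<open>Rt_five_upper\<close>).

  For the lower bound, \<open>intersecting_five\<close> shows that every intersecting family \<open>F\<close> on five points has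
  colour weights \<open>z\<^sub>l \<ge> a\<close> with \<open>z(S) \<ge> a+b\<close> for \<open>S \<in> F\<close> and \<open>z\<^sub>1 + \<dots> + z\<^sub>5 \<le> D\<close>. With these weights every
  vertex pays at least 1 in total, hence some colour has cover cost at least about \<open>n/D\<close>
  (\<open>cover_system_cost\<close>).

  It remains to see that a colour with no tiling of size \<open>t - o(n)\<close> has a cover of cost less than \<open>t\<close>,
  up to few exceptional pairs of vertices. The vertices are partitioned into boundedly many cells
  such that, for almost all pairs of cells, every colour that contains a \<open>K\<^bsub>b,b\<^esub>\<close> between the two cells
  still contains one between any two subsets of a fixed small proportion (\<open>robust_partition\<close>). This is
  much weaker than regularity, and it follows from a monotone potential, namely the number of colours
  present between the cells. It is nevertheless enough to realise any fractional tiling of the cells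
  by greedily choosing copies (\<open>robust_tiling\<close>). Linear programming duality
  (\<open>packing_or_covering\<close>) gives a large fractional tiling or a cheap fractional cover, and a random
  threshold turns the fractional cover into sets \<open>A\<close>, \<open>B\<close> at no extra cost (\<open>cover_rounding\<close>).
\<close>

section \<open>Intersecting families on five points\<close>

lemma two_further_points:
  assumes "X \<subseteq> {1..5::nat}" "card X = k" "k \<le> 3"
  obtains s t where "s \<noteq> t" "s \<in> {1..5} - X" "t \<in> {1..5} - X"
  using assms
proof -
  have "card ({1..5} - X) \<ge> 2" using assms by (subst card_Diff_subset) (auto intro: finite_subset)
  then obtain Y where "Y \<subseteq> {1..5} - X" "card Y = 2"
    by (meson obtain_subset_with_card_n)
  then show ?thesis using that by (auto simp: card_2_iff)
qed

lemma five_enum: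
  assumes "{p,q,r,s,t} \<subseteq> {1..5::nat}" "distinct [p,q,r,s,t]"
  shows "{1..5} = {p,q,r,s,t}"
proof -
  have "card {p,q,r,s,t} = 5" using assms(2) by auto
  with assms(1) show ?thesis by (intro card_subset_eq[symmetric]) auto
qed

lemma sum_five:
  fixes z :: "nat \<Rightarrow> real"
  assumes "distinct [p,q,r,s,t]" "S \<subseteq> {p,q,r,s,t}"
  shows "sum z S = (if p \<in> S then z p else 0) + (if q \<in> S then z q else 0)
    + (if r \<in> S then z r else 0) + (if s \<in> S then z s else 0) + (if t \<in> S then z t else 0)"
proof -
  have "sum z S = (\<Sum>i\<in>{p,q,r,s,t}. if i \<in> S then z i else 0)"
    using assms(2) by (subst sum.inter_restrict[symmetric]) (auto intro: sum.cong simp: Int_absorb1)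
  then show ?thesis using assms(1) by (simp add: add.assoc)
qed

lemma proper_superset_point:
  assumes "S \<noteq> X" "S \<subseteq> U"
  shows "X \<subseteq> S \<Longrightarrow> \<exists>x\<in>U. x \<in> S \<and> x \<notin> X"
  using assms by blast

text \<open>
  Weights on five points given by five numbers. The sum over a set is spelled out as a sum of five
  conditionals, so that membership facts about the set reduce each instance to linear arithmetic.
\<close>

lemma weights_five:
  fixes zp zq zr zs zt :: real and F :: "nat set set"
  assumes F: "\<And>S. S \<in> F \<Longrightarrow> S \<subseteq> {1..5}"
    and e: "{p,q,r,s,t} \<subseteq> {1..5}" "distinct [p,q,r,s,t]"
    and z: "m \<le> zp" "m \<le> zq" "m \<le> zr" "m \<le> zs" "m \<le> zt" "zp + zq + zr + zs + zt \<le> D"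
    and S: "\<And>S. S \<in> F \<Longrightarrow> K \<le> (if p \<in> S then zp else 0) + (if q \<in> S then zq else 0)
    + (if r \<in> S then zr else 0) + (if s \<in> S then zs else 0) + (if t \<in> S then zt else 0)"
  shows "\<exists>z. (\<forall>i\<in>{1..5::nat}. m \<le> z i) \<and> (\<forall>S\<in>F. K \<le> sum z S) \<and> sum z {1..5} \<le> D"
proof -
  define z where "z = (\<lambda>_. 0)(p:=zp,q:=zq,r:=zr,s:=zs,t:=zt)"
  have v: "z p = zp" "z q = zq" "z r = zr" "z s = zs" "z t = zt"
    using e(2) by (auto simp: z_def)
  note E = five_enum[OF e]
  show ?thesis
  proof (intro exI[of _ z] conjI ballI)
    show "m \<le> z i" if "i \<in> {1..5}" for i using that z v unfolding E by auto
    show "K \<le> sum z S" if "S \<in> F" for S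
      using S[OF that] sum_five[OF e(2), of S z] F[OF that] unfolding E v by simp
    show "sum z {1..5} \<le> D" using sum_five[OF e(2), of "{1..5}" z] z(6) unfolding E v by simp
  qed
qed

text \<open>
  The proof follows the two-element members of \<open>F\<close> once \<open>F\<close> has no singleton (a singleton \<open>{p}\<close> puts
  \<open>p\<close> into every member). These pairs form a triangle, a star with four, three, two or one edges, or
  there are none. In each case the pairs restrict the other members so much that weights
  proportional to a short integer vector work: \<open>(1,1,1,0,0)\<close> for the triangle, \<open>(3,1,1,1,1)\<close>,
  \<open>(2,1,1,1,0)\<close>, \<open>(3,2,2,1,1)\<close>, \<open>(2,2,1,1,1)\<close> for the stars, and \<open>(1,1,1,1,1)\<close> without pairs. When
  this puts an entry below \<open>a\<close>, that entry is raised to \<open>a\<close> and the others are adjusted.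
  The bounds on \<open>D\<close> are the totals of the weights for a singleton, the triangle, the star with three edges and the star with two edges.
\<close>

lemma intersecting_five:
  fixes F :: "nat set set" and a b D :: real
  assumes F: "\<And>S. S \<in> F \<Longrightarrow> S \<subseteq> {1..5}"
    and I: "\<And>S T. S \<in> F \<Longrightarrow> T \<in> F \<Longrightarrow> S \<inter> T \<noteq> {}"
    and a: "0 < a" "a \<le> b"
    and D: "5*a+b \<le> D" "(7*a+3*b)/2 \<le> D" "(8*a+5*b)/3 \<le> D" "9*(a+b)/5 \<le> D"
  shows "\<exists>z. (\<forall>i\<in>{1..5::nat}. a \<le> z i) \<and> (\<forall>S\<in>F. a + b \<le> sum z S) \<and> sum z {1..5} \<le> D"
proof -
  have ne: "S \<noteq> {}" if "S \<in> F" for S using I[OF that that] by auto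
  have mem: "p \<in> S \<or> q \<in> S" if "{p,q} \<in> F" "S \<in> F" for p q S using I[OF that] by auto
  have pts: "p \<in> {1..5} \<and> q \<in> {1..5}" if "{p,q} \<in> F" for p q using F[OF that] by simp
  show ?thesis
  proof (cases "\<exists>p. {p} \<in> F")
    case True
    then obtain p where p: "{p} \<in> F" by auto
    then have p5: "p \<in> {1..5}" using F[OF p] by simp
    obtain q r where qr: "q \<noteq> r" "q \<in> {1..5} - {p}" "r \<in> {1..5} - {p}"
      using two_further_points[of "{p}" 1] p5 by auto
    obtain s t where st: "s \<noteq> t" "s \<in> {1..5} - {p,q,r}" "t \<in> {1..5} - {p,q,r}"
      using two_further_points[of "{p,q,r}" 3] p5 qr by auto
    show ?thesis
    proof (rule weights_five[OF F, where p=p and q=q and r=r and s=s and t=t and zp="a+b" and zq=a and zr=a and zs=a and zt=a])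
      fix S assume "S \<in> F"
      then have "p \<in> S" using I[OF p] by auto
      then show "a + b \<le> (if p \<in> S then a+b else 0) + (if q \<in> S then a else 0)
        + (if r \<in> S then a else 0) + (if s \<in> S then a else 0) + (if t \<in> S then a else 0)"
        using a by simp
    qed (use a D p5 qr st in auto)
  next
    case no1: False
    have n1: "S \<noteq> {x}" if "S \<in> F" for S x using no1 that by auto
    show ?thesis
    proof (cases "\<exists>p q r. distinct [p,q,r] \<and> {p,q} \<in> F \<and> {p,r} \<in> F \<and> {q,r} \<in> F")
      case True
      then obtain p q r where pqr: "distinct [p,q,r]" "{p,q} \<in> F" "{p,r} \<in> F" "{q,r} \<in> F" by blast
      have p5: "p \<in> {1..5}" "q \<in> {1..5}" "r \<in> {1..5}" using pts pqr by blast+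
      obtain s t where st: "s \<noteq> t" "s \<in> {1..5} - {p,q,r}" "t \<in> {1..5} - {p,q,r}"
        using two_further_points[of "{p,q,r}" 3] pqr p5 by auto
      show ?thesis
      proof (rule weights_five[OF F, where p=p and q=q and r=r and s=s and t=t and zp="(a+b)/2" and zq="(a+b)/2" and zr="(a+b)/2" and zs=a and zt=a])
        fix S assume "S \<in> F"
        then show "a + b \<le> (if p \<in> S then (a+b)/2 else 0) + (if q \<in> S then (a+b)/2 else 0)
          + (if r \<in> S then (a+b)/2 else 0) + (if s \<in> S then a else 0) + (if t \<in> S then a else 0)"
          using mem[OF pqr(2), of S] mem[OF pqr(3), of S] mem[OF pqr(4), of S] a by (auto simp: field_simps)
      qed (use a D p5 pqr st in \<open>auto simp: field_simps\<close>)
    next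
      case tri: False
      have no_tri: "{q,r} \<notin> F" if "distinct [p,q,r]" "{p,q} \<in> F" "{p,r} \<in> F" for p q r
        using tri that by blast
      show ?thesis
      proof (cases "\<exists>p q. p \<noteq> q \<and> {p,q} \<in> F")
        case no2: False
        show ?thesis
        \<comment> \<open>Every member has at least three points.\<close>
        proof (rule weights_five[OF F, where p=1 and q=2 and r=3 and s=4 and t=5 and zp="max a ((a+b)/3)"
             and zq="max a ((a+b)/3)" and zr="max a ((a+b)/3)" and zs="max a ((a+b)/3)" and zt="max a ((a+b)/3)"])
          fix S assume S: "S \<in> F"
          have "S \<noteq> {x,y}" for x y using no2 no1 S by (cases "x = y") auto
          then have x: "\<exists>z\<in>S. z \<noteq> x \<and> z \<noteq> y" if "x \<in> S" "y \<in> S" for x y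
            using that by blast
          obtain x where x1: "x \<in> S" using ne[OF S] by auto
          obtain y where x2: "y \<in> S" "y \<noteq> x" using x[OF x1 x1] by auto
          obtain w where x3: "w \<in> S" "w \<noteq> x" "w \<noteq> y" using x[OF x1 x2(1)] by auto
          define m where "m = max a ((a+b)/3)"
          have m: "a + b \<le> 3*m" "0 \<le> m" using a by (auto simp: m_def field_simps max_def)
          have "x \<in> {1,2,3,4,5}" "y \<in> {1,2,3,4,5}" "w \<in> {1,2,3,4,5}" using F[OF S] x1 x2 x3 five_enum[of 1 2 3 4 5] by auto
          then have "a + b \<le> (if 1 \<in> S then m else 0) + (if 2 \<in> S then m else 0)
            + (if 3 \<in> S then m else 0) + (if 4 \<in> S then m else 0) + (if 5 \<in> S then m else 0)"
            using x1 x2 x3 m by auto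
          then show "a + b \<le> (if 1 \<in> S then max a ((a+b)/3) else 0) + (if 2 \<in> S then max a ((a+b)/3) else 0)
            + (if 3 \<in> S then max a ((a+b)/3) else 0) + (if 4 \<in> S then max a ((a+b)/3) else 0) + (if 5 \<in> S then max a ((a+b)/3) else 0)"
            by (simp only: m_def)
        qed (use a D in \<open>auto simp: field_simps max_def\<close>)
      next
        case True
        then obtain p q where pq: "p \<noteq> q" "{p,q} \<in> F" by auto
        show ?thesis
        proof (cases "\<exists>p q r. distinct [p,q,r] \<and> {p,q} \<in> F \<and> {p,r} \<in> F")
          case no3: False
          have p5: "p \<in> {1..5}" "q \<in> {1..5}" using pts pq by blast+
          obtain r s where rs: "r \<noteq> s" "r \<in> {1..5} - {p,q}" "s \<in> {1..5} - {p,q}"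
            using two_further_points[of "{p,q}" 2] pq p5 by auto
          obtain t u where tu: "t \<noteq> u" "t \<in> {1..5} - {p,r,s}" "u \<in> {1..5} - {p,r,s}"
            using two_further_points[of "{p,r,s}" 3] p5 rs by auto
          obtain t where t: "t \<in> {1..5}" "t \<notin> {p,q,r,s}" using tu by (cases "t = q") auto
          have e: "{1..5} = {p,q,r,s,t}" by (rule five_enum) (use p5 rs t pq in auto)
          \<comment> \<open>With \<open>{p,q}\<close> as the only pair, a member that omits \<open>p\<close> or \<open>q\<close> has two further points.\<close>
          define m where "m = max a ((a+b)/4)"
          have m: "a + b \<le> (a+b)/2 + 2*m" "0 \<le> m" using a by (auto simp: m_def field_simps max_def)
          have np: "{x,y} \<notin> F" if "x \<in> {p,q}" "y \<notin> {p,q}" for x y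
          proof -
            have "{p,y} \<notin> F" using no3 pq that by auto
            moreover have "{q,y} \<notin> F" using no3 pq that by (metis distinct_length_2_or_more distinct_singleton insert_commute insertCI)
            ultimately show ?thesis using that by auto
          qed
          show ?thesis
          proof (rule weights_five[OF F, where p=p and q=q and r=r and s=s and t=t and zp="(a+b)/2"
             and zq="(a+b)/2" and zr="m" and zs="m" and zt="m"])
            fix S assume S: "S \<in> F"
            have S5: "S \<subseteq> {p,q,r,s,t}" using F[OF S] e by simp
            have nn: "S \<noteq> {p}" "S \<noteq> {q}" using n1[OF S] by auto
            have nn2: "S \<noteq> {x,y}" if "x \<in> {p,q}" "y \<in> {r,s,t}" for x y
              using np[of x y] that rs t S by auto
            have pq': "p \<in> S \<or> q \<in> S" using mem[OF pq(2) S] .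
            have two: "(r \<in> S \<and> s \<in> S) \<or> (r \<in> S \<and> t \<in> S) \<or> (s \<in> S \<and> t \<in> S)" if "\<not> (p \<in> S \<and> q \<in> S)"
              using that pq' pq(1) rs t proper_superset_point[OF nn(1) S5] proper_superset_point[OF nn(2) S5]
                proper_superset_point[OF nn2[of p r] S5] proper_superset_point[OF nn2[of p s] S5]
                proper_superset_point[OF nn2[of p t] S5] proper_superset_point[OF nn2[of q r] S5]
                proper_superset_point[OF nn2[of q s] S5] proper_superset_point[OF nn2[of q t] S5]
              by simp metis
            show "a + b \<le> (if p \<in> S then (a+b)/2 else 0) + (if q \<in> S then (a+b)/2 else 0)
              + (if r \<in> S then m else 0) + (if s \<in> S then m else 0) + (if t \<in> S then m else 0)"
              using pq' two m a by (auto simp: field_simps)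
          qed (use a D p5 pq rs t in \<open>auto simp: field_simps max_def m_def\<close>)
        next
          case True
          then obtain p q r where pqr: "distinct [p,q,r]" "{p,q} \<in> F" "{p,r} \<in> F" by blast
          have p5: "p \<in> {1..5}" "q \<in> {1..5}" "r \<in> {1..5}" using pts pqr by blast+
          show ?thesis
          proof (cases "\<exists>p q r s. distinct [p,q,r,s] \<and> {p,q} \<in> F \<and> {p,r} \<in> F \<and> {p,s} \<in> F")
            case no4: False
            obtain s t where st: "s \<noteq> t" "s \<in> {1..5} - {p,q,r}" "t \<in> {1..5} - {p,q,r}"
              using two_further_points[of "{p,q,r}" 3] pqr p5 by auto
            have e: "{1..5} = {p,q,r,s,t}" by (rule five_enum) (use p5 pqr st in auto)
            \<comment> \<open>A star with exactly two edges; \<open>{q,r}\<close> would close a triangle.\<close>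
            have n: "{p,s} \<notin> F" "{p,t} \<notin> F" "{q,r} \<notin> F"
              using no4 pqr st no_tri by auto
            have sh: "p \<in> S \<and> (q \<in> S \<or> r \<in> S \<or> (s \<in> S \<and> t \<in> S)) \<or> q \<in> S \<and> r \<in> S \<and> (s \<in> S \<or> t \<in> S)"
              if S: "S \<in> F" for S
            proof -
              have S5: "S \<subseteq> {p,q,r,s,t}" using F[OF S] e by simp
              have ne: "S \<noteq> {p}" "S \<noteq> {p,s}" "S \<noteq> {p,t}" "S \<noteq> {q,r}" using n n1[OF S] S by auto
              show ?thesis
                using mem[OF pqr(2) S] mem[OF pqr(3) S] pqr(1) st proper_superset_point[OF ne(1) S5]
                  proper_superset_point[OF ne(2) S5] proper_superset_point[OF ne(3) S5] proper_superset_point[OF ne(4) S5]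
                by simp metis
            qed
            consider "4*a \<le> b" | "b < 4*a" "2*a \<le> b" | "b < 2*a" by linarith
            then show ?thesis
            proof cases
              case 1
              show ?thesis
              proof (rule weights_five[OF F, where p=p and q=q and r=r and s=s and t=t and zp="3*(a+b)/5"
                 and zq="2*(a+b)/5" and zr="2*(a+b)/5" and zs="(a+b)/5" and zt="(a+b)/5"])
                fix S assume "S \<in> F"
                then show "a + b \<le> (if p \<in> S then 3*(a+b)/5 else 0) + (if q \<in> S then 2*(a+b)/5 else 0)
                  + (if r \<in> S then 2*(a+b)/5 else 0) + (if s \<in> S then (a+b)/5 else 0) + (if t \<in> S then (a+b)/5 else 0)"
                  using sh a by (auto simp: field_simps)
              qed (use 1 a D p5 pqr st in \<open>auto simp: field_simps\<close>)
            next
              case 2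
              show ?thesis
              proof (rule weights_five[OF F, where p=p and q=q and r=r and s=s and t=t and zp="a+b/2"
                 and zq="b/2" and zr="b/2" and zs="a" and zt="a"])
                fix S assume "S \<in> F"
                then show "a + b \<le> (if p \<in> S then a+b/2 else 0) + (if q \<in> S then b/2 else 0)
                  + (if r \<in> S then b/2 else 0) + (if s \<in> S then a else 0) + (if t \<in> S then a else 0)"
                  using sh[of S] a 2 by auto
              qed (use 2 a D p5 pqr st in \<open>auto simp: field_simps\<close>)
            next
              case 3
              show ?thesis
              proof (rule weights_five[OF F, where p=p and q=q and r=r and s=s and t=t and zp="b"
                 and zq="a" and zr="a" and zs="a" and zt="a"])
                fix S assume "S \<in> F"
                then show "a + b \<le> (if p \<in> S then b else 0) + (if q \<in> S then a else 0)
                  + (if r \<in> S then a else 0) + (if s \<in> S then a else 0) + (if t \<in> S then a else 0)"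
                  using sh[of S] a 3 by auto
              qed (use 3 a D p5 pqr st in \<open>auto simp: field_simps\<close>)
            qed
          next
            case True
            then obtain p q r s where pqrs: "distinct [p,q,r,s]" "{p,q} \<in> F" "{p,r} \<in> F" "{p,s} \<in> F" by blast
            have p5: "p \<in> {1..5}" "q \<in> {1..5}" "r \<in> {1..5}" "s \<in> {1..5}" using pts pqrs by blast+
            obtain t u where tu: "t \<noteq> u" "t \<in> {1..5} - {p,q,r}" "u \<in> {1..5} - {p,q,r}"
              using two_further_points[of "{p,q,r}" 3] pqrs p5 by auto
            obtain t where t: "t \<in> {1..5}" "t \<notin> {p,q,r,s}" using tu by (cases "t = s") auto
            have e: "{1..5} = {p,q,r,s,t}" by (rule five_enum) (use p5 pqrs t in auto)
            have sh: "p \<in> S \<and> (q \<in> S \<or> r \<in> S \<or> s \<in> S \<or> t \<in> S) \<or> q \<in> S \<and> r \<in> S \<and> s \<in> S"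
              if S: "S \<in> F" for S
              using mem[OF pqrs(2) S] mem[OF pqrs(3) S] mem[OF pqrs(4) S] proper_superset_point[OF n1[OF S, of p], of "{p,q,r,s,t}"] F[OF S] e
              by simp metis
            show ?thesis
            \<comment> \<open>The star has four edges or exactly three.\<close>
            proof (cases "{p,t} \<in> F")
              case True
              have sh2: "p \<in> S \<or> t \<in> S" if "S \<in> F" for S using mem[OF True that] .
              define v where "v = max 0 ((b-3*a)/4)"
              have v: "0 \<le> v" "v = 0 \<or> v = (b-3*a)/4" "a + b \<le> 4*a+4 * v" by (auto simp: v_def max_def field_simps)
              show ?thesis
              proof (rule weights_five[OF F, where p=p and q=q and r=r and s=s and t=t and zp="b-v"
                 and zq="a+v" and zr="a+v" and zs="a+v" and zt="a+v"])
                fix S assume "S \<in> F"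
                then show "a + b \<le> (if p \<in> S then b-v else 0) + (if q \<in> S then a+v else 0)
                  + (if r \<in> S then a+v else 0) + (if s \<in> S then a+v else 0) + (if t \<in> S then a+v else 0)"
                  using sh[of S] sh2[of S] a v by auto
              qed (use v a D p5 pqrs t in \<open>auto simp: field_simps\<close>)
            next
              case False
              have sh2: "p \<in> S \<and> (q \<in> S \<or> r \<in> S \<or> s \<in> S) \<or> q \<in> S \<and> r \<in> S \<and> s \<in> S" if S: "S \<in> F" for S
              proof -
                have "S \<noteq> {p,t}" using False S by auto
                from proper_superset_point[OF this, of "{p,q,r,s,t}"] show ?thesis
                  using sh[OF S] F[OF S] e by simp metis
              qed
              define v where "v = max 0 ((b-2*a)/3)"
              have v: "0 \<le> v" "v = 0 \<or> v = (b-2*a)/3" "a + b \<le> 3*a+3 * v" by (auto simp: v_def max_def field_simps)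
              show ?thesis
              proof (rule weights_five[OF F, where p=p and q=q and r=r and s=s and t=t and zp="b-v"
                 and zq="a+v" and zr="a+v" and zs="a+v" and zt="a"])
                fix S assume "S \<in> F"
                then show "a + b \<le> (if p \<in> S then b-v else 0) + (if q \<in> S then a+v else 0)
                  + (if r \<in> S then a+v else 0) + (if s \<in> S then a+v else 0) + (if t \<in> S then a else 0)"
                  using sh2[of S] a v by auto
              qed (use v a D p5 pqrs t in \<open>auto simp: field_simps\<close>)
            qed
          qed
        qed
      qed
    qed
  qed
qed

section \<open>Packing or covering: linear programming duality\<close>

text \<open>
  The inequalities that follow from \<open>C\<close> by adding and scaling, where the pair \<open>(f,\<beta>)\<close> stands for
  the linear inequality \<open>f \<bullet> x \<le> \<beta>\<close>.
\<close>

inductive_set conic :: "(('v \<Rightarrow> real) \<times> real) set \<Rightarrow> (('v \<Rightarrow> real) \<times> real) set" for C where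
  base: "x \<in> C \<Longrightarrow> x \<in> conic C"
| add: "(f,\<beta>) \<in> conic C \<Longrightarrow> (g,\<gamma>) \<in> conic C \<Longrightarrow> (\<lambda>v. f v + g v, \<beta> + \<gamma>) \<in> conic C"
| scale: "0 \<le> k \<Longrightarrow> (f,\<beta>) \<in> conic C \<Longrightarrow> (\<lambda>v. k * f v, k * \<beta>) \<in> conic C"

lemma conic_subset_conic:
  assumes "C' \<subseteq> conic C" shows "conic C' \<subseteq> conic C"
proof
  fix x assume "x \<in> conic C'"
  then show "x \<in> conic C" by (induction rule: conic.induct) (use assms in \<open>auto intro: conic.intros\<close>)
qed

lemma real_between_finite:
  fixes L U :: "real set"
  assumes "finite L" "finite U" "\<And>l u. l \<in> L \<Longrightarrow> u \<in> U \<Longrightarrow> l \<le> u"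
  shows "\<exists>y. (\<forall>l\<in>L. l \<le> y) \<and> (\<forall>u\<in>U. y \<le> u)"
proof (cases "L = {}")
  case False
  then show ?thesis using assms by (intro exI[of _ "Max L"]) auto
next
  case True
  then show ?thesis using assms by (cases "U = {}") (auto intro!: exI[of _ "Min U"])
qed

text \<open>
  Fourier-Motzkin elimination. To remove a variable \<open>v\<close>, every inequality with positive coefficient
  at \<open>v\<close> is combined with every one with negative coefficient so that \<open>v\<close> cancels. If the new system
  is infeasible, induction applies, since its members are conic combinations of the old ones.
  Otherwise a solution extends to \<open>v\<close>, because the combined inequalities say that each lower
  bound on \<open>v\<close> is at most each upper bound.
\<close>

lemma farkas:
  fixes C :: "(('v \<Rightarrow> real) \<times> real) set"
  assumes "finite V" "finite C"
    and "\<And>x. \<exists>(f,\<beta>)\<in>C. \<beta> < (\<Sum>v\<in>V. f v * x v)"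
  shows "\<exists>(g,\<gamma>)\<in>conic C. (\<forall>v\<in>V. g v = 0) \<and> \<gamma> < 0"
  using assms
proof (induction V arbitrary: C rule: finite_induct)
  case empty
  then obtain f \<beta> where "(f,\<beta>) \<in> C" "\<beta> < 0" by fastforce
  then show ?case by (auto intro: conic.base)
next
  case (insert v V)
  define Z where "Z = {(f,\<beta>)\<in>C. f v = 0}"
  define P where "P = {(f,\<beta>)\<in>C. 0 < f v}"
  define N where "N = {(f,\<beta>)\<in>C. f v < 0}"
  define comb where "comb = (\<lambda>((f,\<beta>),(g,\<gamma>)). (\<lambda>u. (- g v) * f u + f v * g u, (- g v) * \<beta> + f v * \<gamma> :: real))"
  define C' where "C' = Z \<union> comb ` (P \<times> N)"
  have fin: "finite Z" "finite P" "finite N" "finite C'"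
    using insert.prems(1) by (auto simp: Z_def P_def N_def C'_def intro: finite_subset[of _ C])
  have C'sub: "C' \<subseteq> conic C"
  proof
    fix x assume "x \<in> C'"
    then consider "x \<in> Z" | f \<beta> g \<gamma> where "(f,\<beta>) \<in> P" "(g,\<gamma>) \<in> N" "x = comb ((f,\<beta>),(g,\<gamma>))"
      by (auto simp: C'_def)
    then show "x \<in> conic C"
    proof cases
      case 1 then show ?thesis by (auto simp: Z_def intro: conic.base)
    next
      case 2
      then have "0 \<le> - g v" "0 \<le> f v" "(f,\<beta>) \<in> conic C" "(g,\<gamma>) \<in> conic C"
        by (auto simp: P_def N_def intro: conic.base)
      then have "(\<lambda>u. (- g v) * f u, (- g v) * \<beta>) \<in> conic C" "(\<lambda>u. f v * g u, f v * \<gamma>) \<in> conic C"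
        by (blast intro: conic.scale)+
      from conic.add[OF this] show ?thesis using 2 by (simp add: comb_def)
    qed
  qed
  have C'v: "f v = 0" if "(f,\<beta>) \<in> conic C'" for f \<beta>
  proof -
    have "(fst x) v = 0" if "x \<in> conic C'" for x using that
      by (induction rule: conic.induct) (auto simp: C'_def Z_def comb_def)
    from this[OF that] show ?thesis by simp
  qed
  show ?case
  proof (cases "\<exists>x. \<forall>(f,\<beta>)\<in>C'. (\<Sum>u\<in>V. f u * x u) \<le> \<beta>")
    case False
    then have "\<And>x. \<exists>(f,\<beta>)\<in>C'. \<beta> < (\<Sum>u\<in>V. f u * x u)" by (force simp: not_le)
    from insert.IH[OF fin(4) this] obtain g \<gamma> where g: "(g,\<gamma>) \<in> conic C'" "\<forall>u\<in>V. g u = 0" "\<gamma> < 0" by auto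
    then have "(g,\<gamma>) \<in> conic C" using conic_subset_conic[OF C'sub] by auto
    then show ?thesis using g C'v[OF g(1)] by auto
  next
    case True
    then obtain x where x: "\<And>f \<beta>. (f,\<beta>) \<in> C' \<Longrightarrow> (\<Sum>u\<in>V. f u * x u) \<le> \<beta>" by blast
    define bd where "bd = (\<lambda>(f,\<beta>). (\<beta> - (\<Sum>u\<in>V. f u * x u)) / f v)"
    have le: "bd n \<le> bd p" if n: "n \<in> N" and p: "p \<in> P" for n p
    proof -
      obtain f \<beta> g \<gamma> where fg: "p = (f,\<beta>)" "n = (g,\<gamma>)" by (cases p, cases n)
      have s: "0 < f v" "g v < 0" using that fg by (auto simp: P_def N_def)
      have "(\<lambda>u. (- g v) * f u + f v * g u, (- g v) * \<beta> + f v * \<gamma>) \<in> C'"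
      proof -
        have "comb ((f,\<beta>),(g,\<gamma>)) \<in> C'" using n p fg unfolding C'_def by blast
        then show ?thesis by (simp add: comb_def)
      qed
      from x[OF this] have "(- g v) * (\<Sum>u\<in>V. f u * x u) + f v * (\<Sum>u\<in>V. g u * x u) \<le> (- g v) * \<beta> + f v * \<gamma>"
        by (simp add: sum_distrib_left sum.distrib sum_negf sum_subtractf algebra_simps)
      then show ?thesis using s by (simp add: bd_def fg field_simps)
    qed
    have "\<exists>y. (\<forall>l\<in>bd ` N. l \<le> y) \<and> (\<forall>u\<in>bd ` P. y \<le> u)"
      by (rule real_between_finite) (use fin le in auto)
    then obtain y where y: "\<And>n. n \<in> N \<Longrightarrow> bd n \<le> y" "\<And>p. p \<in> P \<Longrightarrow> y \<le> bd p" by auto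
    obtain f \<beta> where f: "(f,\<beta>) \<in> C" "\<beta> < (\<Sum>u\<in>insert v V. f u * (x(v:=y)) u)"
      using insert.prems(2)[of "x(v:=y)"] by auto
    have "(\<Sum>u\<in>V. f u * (x(v:=y)) u) = (\<Sum>u\<in>V. f u * x u)"
      by (rule sum.cong) (use insert.hyps in auto)
    then have lt: "\<beta> < f v * y + (\<Sum>u\<in>V. f u * x u)" using f insert.hyps by simp
    consider "f v = 0" | "0 < f v" | "f v < 0" by linarith
    then have False
    proof cases
      case 1
      then have "(f,\<beta>) \<in> C'" using f by (auto simp: C'_def Z_def)
      from x[OF this] show False using lt 1 by simp
    next
      case 2
      then have "y \<le> bd (f,\<beta>)" using f by (intro y) (auto simp: P_def)
      then show False using lt 2 by (simp add: bd_def field_simps)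
    next
      case 3
      then have "bd (f,\<beta>) \<le> y" using f by (intro y) (auto simp: N_def)
      then show False using lt 3 by (simp add: bd_def field_simps)
    qed
    then show ?thesis ..
  qed
qed

text \<open>
  Strong duality in the form needed here, for a target value \<open>\<theta>\<close>: if no fractional packing reaches \<open>\<theta>\<close>,
  the multipliers \<open>\<mu>\<^sub>i\<close> of the capacity constraints and \<open>\<kappa>\<close> of the constraint \<open>\<theta> \<le> \<Sum> w\<close> in an infeasibility
  certificate satisfy \<open>\<kappa> > 0\<close>, and \<open>\<mu>/\<kappa>\<close> is a cover.
\<close>

lemma packing_or_covering:
  fixes M :: "'e \<Rightarrow> 'i \<Rightarrow> real" and s :: "'i \<Rightarrow> real"
  assumes fin: "finite E" "finite I" and s: "\<And>i. i \<in> I \<Longrightarrow> 0 \<le> s i"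
  shows "(\<exists>w. (\<forall>e\<in>E. 0 \<le> w e) \<and> (\<forall>i\<in>I. (\<Sum>e\<in>E. M e i * w e) \<le> s i) \<and> \<theta> \<le> (\<Sum>e\<in>E. w e)) \<or>
         (\<exists>c. (\<forall>i\<in>I. 0 \<le> c i) \<and> (\<forall>e\<in>E. 1 \<le> (\<Sum>i\<in>I. M e i * c i)) \<and> (\<Sum>i\<in>I. s i * c i) < \<theta>)"
proof (cases "\<exists>w. (\<forall>e\<in>E. 0 \<le> w e) \<and> (\<forall>i\<in>I. (\<Sum>e\<in>E. M e i * w e) \<le> s i) \<and> \<theta> \<le> (\<Sum>e\<in>E. w e)")
  case True
  then show ?thesis by (rule disjI1)
next
  case no: False
  define C where "C = (\<lambda>e. (\<lambda>e'. if e' = e then -1 else 0 :: real, 0 :: real)) ` E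
     \<union> (\<lambda>i. (\<lambda>e. M e i, s i)) ` I \<union> {(\<lambda>_. -1, - \<theta>)}"
  have "\<exists>(f,\<beta>)\<in>C. \<beta> < (\<Sum>e\<in>E. f e * w e)" for w
  proof (rule ccontr)
    assume "\<not> ?thesis"
    then have all: "\<And>f \<beta>. (f,\<beta>) \<in> C \<Longrightarrow> (\<Sum>e\<in>E. f e * w e) \<le> \<beta>" by force
    have "0 \<le> w e" if "e \<in> E" for e
    proof -
      have "(\<Sum>e'\<in>E. (if e' = e then -1 else 0) * w e') \<le> 0"
        using that by (intro all) (auto simp: C_def)
      also have "(\<Sum>e'\<in>E. (if e' = e then -1 else 0) * w e') = (\<Sum>e'\<in>E. if e' = e then - w e' else 0)"
        by (rule sum.cong) auto
      finally show ?thesis using that fin by simp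
    qed
    moreover have "(\<Sum>e\<in>E. M e i * w e) \<le> s i" if "i \<in> I" for i
      using that by (intro all) (auto simp: C_def)
    moreover have "(\<Sum>e\<in>E. -1 * w e) \<le> - \<theta>" by (intro all) (auto simp: C_def)
    ultimately show False using no[unfolded not_ex, THEN spec, of w] by (simp add: sum_negf)
  qed
  then obtain g \<gamma> where g: "(g,\<gamma>) \<in> conic C" "\<forall>e\<in>E. g e = 0" "\<gamma> < 0"
    using farkas[of E C] fin by (auto simp: C_def)
  have "\<exists>\<mu> \<kappa>. (\<forall>i\<in>I. 0 \<le> \<mu> i) \<and> 0 \<le> \<kappa> \<and> (\<forall>e\<in>E. fst x e \<le> (\<Sum>i\<in>I. M e i * \<mu> i) - \<kappa>)
      \<and> (\<Sum>i\<in>I. s i * \<mu> i) - \<kappa> * \<theta> \<le> snd x" if "x \<in> conic C" for x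
    using that
  proof (induction rule: conic.induct)
    case (base x)
    then consider e where "e \<in> E" "x = (\<lambda>e'. if e' = e then -1 else 0, 0)"
      | i where "i \<in> I" "x = (\<lambda>e. M e i, s i)" | "x = (\<lambda>_. -1, - \<theta>)"
      by (auto simp: C_def)
    then show ?case
    proof cases
      case 1 then show ?thesis by (intro exI[of _ "\<lambda>_. 0"] exI[of _ 0]) auto
    next
      case 2
      have "(\<Sum>j\<in>I. h j * (if j = i then 1 else 0)) = h i" for h :: "'i \<Rightarrow> real"
        using 2 fin by (simp add: if_distrib cong: if_cong)
      then show ?thesis using 2 by (intro exI[of _ "\<lambda>j. if j = i then 1 else 0"] exI[of _ 0]) auto
    next
      case 3 then show ?thesis by (intro exI[of _ "\<lambda>_. 0"] exI[of _ 1]) auto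
    qed
  next
    case (add f \<beta> g \<gamma>)
    then obtain \<mu> \<kappa> \<mu>' \<kappa>' where *: "\<forall>i\<in>I. 0 \<le> \<mu> i" "0 \<le> \<kappa>" "\<forall>e\<in>E. f e \<le> (\<Sum>i\<in>I. M e i * \<mu> i) - \<kappa>"
        "(\<Sum>i\<in>I. s i * \<mu> i) - \<kappa> * \<theta> \<le> \<beta>"
        "\<forall>i\<in>I. 0 \<le> \<mu>' i" "0 \<le> \<kappa>'" "\<forall>e\<in>E. g e \<le> (\<Sum>i\<in>I. M e i * \<mu>' i) - \<kappa>'"
        "(\<Sum>i\<in>I. s i * \<mu>' i) - \<kappa>' * \<theta> \<le> \<gamma>" by auto
    show ?case
    proof (intro exI conjI ballI)
      have sd: "(\<Sum>i\<in>I. h i * (\<mu> i + \<mu>' i)) = (\<Sum>i\<in>I. h i * \<mu> i) + (\<Sum>i\<in>I. h i * \<mu>' i)" for h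
        by (simp add: distrib_left sum.distrib)
      show "fst (\<lambda>v. f v + g v, \<beta> + \<gamma>) e \<le> (\<Sum>i\<in>I. M e i * (\<mu> i + \<mu>' i)) - (\<kappa> + \<kappa>')" if "e \<in> E" for e
        using *(3,7) that unfolding sd fst_conv by fastforce
      show "(\<Sum>i\<in>I. s i * (\<mu> i + \<mu>' i)) - (\<kappa> + \<kappa>') * \<theta> \<le> snd (\<lambda>v. f v + g v, \<beta> + \<gamma>)"
        using *(4,8) unfolding sd snd_conv by (simp add: distrib_right)
    qed (use * in auto)
  next
    case (scale k f \<beta>)
    then obtain \<mu> \<kappa> where *: "\<forall>i\<in>I. 0 \<le> \<mu> i" "0 \<le> \<kappa>" "\<forall>e\<in>E. f e \<le> (\<Sum>i\<in>I. M e i * \<mu> i) - \<kappa>"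
        "(\<Sum>i\<in>I. s i * \<mu> i) - \<kappa> * \<theta> \<le> \<beta>" by auto
    have sc: "(\<Sum>i\<in>I. h i * (k * \<mu> i)) = k * (\<Sum>i\<in>I. h i * \<mu> i)" for h
      by (simp add: sum_distrib_left mult.left_commute)
    have "k * f e \<le> k * ((\<Sum>i\<in>I. M e i * \<mu> i) - \<kappa>)" if "e \<in> E" for e
      using * scale(1) that by (intro mult_left_mono) auto
    moreover have "k * ((\<Sum>i\<in>I. s i * \<mu> i) - \<kappa> * \<theta>) \<le> k * \<beta>"
      using * scale(1) by (intro mult_left_mono) auto
    ultimately show ?case
      by (intro exI[of _ "\<lambda>i. k * \<mu> i"] exI[of _ "k * \<kappa>"])
         (use * scale(1) in \<open>auto simp only: sc fst_conv snd_conv right_diff_distrib mult.assoc mult_nonneg_nonneg\<close>)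
  qed
  from this[OF g(1)] g(2,3) obtain \<mu> \<kappa> where \<mu>: "\<forall>i\<in>I. 0 \<le> \<mu> i" "0 \<le> \<kappa>"
      "\<forall>e\<in>E. 0 \<le> (\<Sum>i\<in>I. M e i * \<mu> i) - \<kappa>" "(\<Sum>i\<in>I. s i * \<mu> i) - \<kappa> * \<theta> < 0"
    by fastforce
  have "0 \<le> (\<Sum>i\<in>I. s i * \<mu> i)" using \<mu>(1) s by (intro sum_nonneg) auto
  then have \<kappa>: "0 < \<kappa>" using \<mu>(2,4) by (cases "\<kappa> = 0") auto
  have sd: "(\<Sum>i\<in>I. h i * (\<mu> i / \<kappa>)) = (\<Sum>i\<in>I. h i * \<mu> i) / \<kappa>" for h
    by (simp add: sum_divide_distrib)
  show ?thesis
    by (intro disjI2 exI[of _ "\<lambda>i. \<mu> i / \<kappa>"] conjI) (use \<mu> \<kappa> in \<open>auto simp only: sd pos_le_divide_eq pos_divide_less_eq divide_nonneg_pos mult_1_left mult.commute[of \<theta>] diff_ge_0_iff_ge diff_less_0_iff_less\<close>)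
qed

section \<open>Rounding a fractional cover\<close>

text \<open>
  Only finitely many values occur, so that exceeding \<open>S\<close> everywhere means exceeding it by a fixed
  margin, and this contradicts the mean value.
\<close>

lemma value_below_mean:
  fixes g :: "real \<Rightarrow> real"
  assumes h: "0 < h" and fin: "finite (g ` {0..h})" and int: "(g has_integral J) {0..h}" and J: "J \<le> h * S"
  shows "\<exists>x. 0 \<le> x \<and> x \<le> h \<and> g x \<le> S"
proof (rule ccontr)
  assume "\<not> ?thesis"
  then have gt: "S < g x" if "x \<in> {0..h}" for x
    using that by force
  define m where "m = Min (g ` {0..h})"
  have ne: "g ` {0..h} \<noteq> {}" using h by auto
  have m: "S < m" using gt fin ne by (auto simp: m_def)
  have "((\<lambda>_. m) has_integral (h * m)) {0..h}"
    using has_integral_const_real[of m 0 h] h by simp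
  then have "h * m \<le> J"
    by (rule has_integral_le[OF _ int]) (use fin in \<open>auto simp: m_def\<close>)
  moreover have "h * S < h * m" using m h by simp
  ultimately show False using J by simp
qed

lemma has_integral_lower_step:
  fixes c h :: real assumes "0 \<le> c" "0 \<le> h"
  shows "((\<lambda>x. if x \<le> c then 1 else 0) has_integral (min c h)) {0..h::real}"
proof -
  have "((\<lambda>x. 1::real) has_integral (min c h)) {0..min c h}"
    using has_integral_const_real[of "1::real" 0 "min c h"] assms by (auto simp: min_def)
  then have "((\<lambda>x. if x \<in> {0..min c h} then 1 else 0::real) has_integral (min c h)) {0..h}"
    by (subst has_integral_restrict) auto
  then show ?thesis by (rule has_integral_eq[rotated]) auto
qed

text \<open>
  Fix a threshold \<open>x\<close> and let \<open>A\<close> consist of the indices with \<open>a c\<^sub>i + b x > 1\<close> and \<open>B\<close> of the other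
  indices with \<open>c\<^sub>i \<ge> x\<close>. If neither end of an edge is in \<open>A\<close>, then the covering inequality forces both
  ends to have value at least \<open>x\<close>, so both are in \<open>B\<close>. For \<open>x\<close> uniform in \<open>[0, 1/(a+b)]\<close> the expected cost
  of an index is at most its share \<open>s\<^sub>i c\<^sub>i\<close>, hence some threshold is good.
\<close>

lemma cover_rounding:
  fixes c s :: "'i \<Rightarrow> real" and a b :: real
  assumes ab: "0 < a" "0 < b" and I: "finite I" and c: "\<And>i. i \<in> I \<Longrightarrow> 0 \<le> c i" and s: "\<And>i. i \<in> I \<Longrightarrow> 0 \<le> s i"
    and E: "E \<subseteq> I \<times> I" "sym E" and cov: "\<And>i j. (i,j) \<in> E \<Longrightarrow> 1 \<le> a * c i + b * c j"
  shows "\<exists>A B. A \<subseteq> I \<and> B \<subseteq> I \<and> (\<forall>(i,j)\<in>E. i \<in> A \<or> j \<in> A \<or> i \<in> B \<and> j \<in> B) \<and>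
    sum s A / a + sum s B / (a + b) \<le> (\<Sum>i\<in>I. s i * c i)"
proof -
  \<comment> \<open>Thresholds range over \<open>[0, h]\<close>, and \<open>h\<close> is the least value of a constant cover.\<close>
  define h where "h = 1 / (a + b)"
  have h: "0 < h" "a * h + b * h = 1" using ab by (auto simp: h_def add_divide_distrib[symmetric])
  define A where "A = (\<lambda>x. {i\<in>I. 1 < a * c i + b * x})"
  define B where "B = (\<lambda>x. {i\<in>I. x \<le> c i} - A x)"
  define ind where "ind = (\<lambda>P. if P then 1 else 0 :: real)"
  define g where "g = (\<lambda>x. \<Sum>i\<in>I. s i * (h * ind (x \<le> c i) + (b/a) * h * (1 - ind (x \<le> (1 - a * c i) / b))))"
  have A_high: "h < c i" if "i \<in> A x" "x \<le> h" for i x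
  proof -
    have "1 < a * c i + b * x" using that by (simp add: A_def)
    moreover have "b * x \<le> b * h" using that ab by simp
    ultimately have "a * h < a * c i" using h by linarith
    then show ?thesis using ab by simp
  qed
  have cost: "sum s (A x) / a + sum s (B x) / (a + b) = g x" if "x \<le> h" for x
  proof -
    have sub: "A x \<subseteq> {i\<in>I. x \<le> c i}" using A_high that by (force simp: A_def)
    have "sum s (A x) / a + sum s (B x) / (a + b)
        = (\<Sum>i\<in>I. if i \<in> A x then s i / a else 0) + (\<Sum>i\<in>I. if i \<in> B x then s i / (a+b) else 0)"
      unfolding sum_divide_distrib
      by (subst (1 2) sum.inter_restrict[OF I, symmetric]) (auto intro!: arg_cong2[where f="(+)"] sum.cong simp: A_def B_def)
    also have "\<dots> = g x" unfolding g_def sum.distrib[symmetric]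
    proof (rule sum.cong[OF refl])
      fix i assume i: "i \<in> I"
      have iff: "x \<le> (1 - a * c i) / b \<longleftrightarrow> i \<notin> A x" using i ab by (auto simp: A_def field_simps)
      have "h + b / a * h = (a * h + b * h) / a" using ab by (simp add: field_simps)
      then have e: "s i / a = s i * (h + b / a * h)" using h by simp
      show "(if i \<in> A x then s i / a else 0) + (if i \<in> B x then s i / (a+b) else 0)
        = s i * (h * ind (x \<le> c i) + (b/a) * h * (1 - ind (x \<le> (1 - a * c i) / b)))"
        unfolding iff using i sub e by (auto simp: B_def ind_def) (auto simp: h_def)
    qed
    finally show ?thesis .
  qed
  define J where "J = (\<Sum>i\<in>I. s i * (h * min (c i) h + (b/a) * h * (h - max 0 (min ((1 - a * c i) / b) h))))"
  have int: "(g has_integral J) {0..h}"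
    unfolding g_def J_def
  proof (intro has_integral_sum[OF I] has_integral_mult_right has_integral_add has_integral_diff)
    fix i assume i: "i \<in> I"
    show "((\<lambda>x. ind (x \<le> c i)) has_integral min (c i) h) {0..h}"
      unfolding ind_def using has_integral_lower_step c[OF i] h by simp
    show "((\<lambda>x. 1) has_integral h) {0..h}" using has_integral_const_real[of "1::real" 0 h] h by simp
    show "((\<lambda>x. ind (x \<le> (1 - a * c i) / b)) has_integral max 0 (min ((1 - a * c i) / b) h)) {0..h}"
    proof (cases "0 \<le> (1 - a * c i) / b")
      case True then show ?thesis unfolding ind_def
        using has_integral_lower_step[OF True, of h] h by (simp add: max_def)
    next
      case False
      then show ?thesis unfolding ind_def using h
        by (intro has_integral_eq[OF _ has_integral_0, THEN has_integral_eq_rhs]) auto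
    qed
  qed
  have J: "J \<le> h * (\<Sum>i\<in>I. s i * c i)"
    unfolding J_def sum_distrib_left
  proof (rule sum_mono)
    fix i assume i: "i \<in> I"
    have "h * min (c i) h + (b/a) * h * (h - max 0 (min ((1 - a * c i) / b) h)) \<le> h * c i"
    proof -
      have "min (c i) h + (b/a) * (h - max 0 (min ((1 - a * c i) / b) h)) \<le> c i"
      proof (cases "c i \<le> h")
        case True
        then have "a * c i \<le> a * h" using ab by simp
        then have "b * h \<le> 1 - a * c i" using h by linarith
        then have "h \<le> (1 - a * c i) / b" using ab by (simp add: field_simps)
        then have "min ((1 - a * c i) / b) h = h" "max 0 h = h" "min (c i) h = c i" using True h by auto
        then show ?thesis by simp
      next
        case False
        have "h - max 0 (min ((1 - a * c i) / b) h) \<le> h - (1 - a * c i) / b"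
        proof -
          have "a * h \<le> a * c i" using ab False by simp
          then have "1 - a * c i \<le> b * h" using h by linarith
          then have "(1 - a * c i) / b \<le> h" using ab by (simp add: field_simps)
          then have "min ((1 - a * c i) / b) h = (1 - a * c i) / b" by (rule min_absorb1)
          then show ?thesis by linarith
        qed
        then have "(b/a) * (h - max 0 (min ((1 - a * c i) / b) h)) \<le> (b/a) * (h - (1 - a * c i) / b)"
          using ab by (intro mult_left_mono) auto
        also have "\<dots> = (b * h - 1 + a * c i) / a" using ab by (simp add: field_simps)
        also have "\<dots> = (a * c i - a * h) / a" using h by (simp add: algebra_simps)
        also have "\<dots> = c i - h" using ab by (simp add: field_simps)
        finally show ?thesis using False by simp
      qed
      from mult_left_mono[OF this, of h] h show ?thesis by (simp add: algebra_simps)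
    qed
    from mult_left_mono[OF this s[OF i]]
    show "s i * (h * min (c i) h + (b/a) * h * (h - max 0 (min ((1 - a * c i) / b) h))) \<le> h * (s i * c i)"
      by (simp add: algebra_simps)
  qed
  have "g ` {0..h} \<subseteq> (\<lambda>(X,Y). sum s X / a + sum s Y / (a+b)) ` (Pow I \<times> Pow I)"
  proof
    fix y assume "y \<in> g ` {0..h}"
    then obtain x where "x \<le> h" "y = g x" by auto
    then have "y = (\<lambda>(X,Y). sum s X / a + sum s Y / (a+b)) (A x, B x)" using cost by simp
    moreover have "(A x, B x) \<in> Pow I \<times> Pow I" by (auto simp: A_def B_def)
    ultimately show "y \<in> (\<lambda>(X,Y). sum s X / a + sum s Y / (a+b)) ` (Pow I \<times> Pow I)" by (rule image_eqI)
  qed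
  then have fin: "finite (g ` {0..h})" by (rule finite_subset) (use I in simp)
  obtain x where x: "0 \<le> x" "x \<le> h" "g x \<le> (\<Sum>i\<in>I. s i * c i)"
    using value_below_mean[OF h(1) fin int J] by blast
  have edge: "i \<in> A x \<or> j \<in> A x \<or> i \<in> B x \<and> j \<in> B x" if ij: "(i,j) \<in> E" for i j
  proof -
    have ji: "(j,i) \<in> E" using ij E by (auto simp: sym_def)
    have "x \<le> c l" if "(k,l) \<in> E" "k \<notin> A x" for k l
    proof -
      have "b * x \<le> b * c l" using that cov[OF that(1)] E by (auto simp: A_def)
      then show ?thesis using ab by simp
    qed
    then show ?thesis using ij ji E by (auto simp: B_def)
  qed
  show ?thesis
  proof (rule exI[where x = "A x"], rule exI[where x = "B x"], intro conjI ballI)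
    show "A x \<subseteq> I" "B x \<subseteq> I" by (auto simp: A_def B_def)
    show "sum s (A x) / a + sum s (B x) / (a + b) \<le> (\<Sum>i\<in>I. s i * c i)" using cost[OF x(2)] x(3) by simp
    fix e assume "e \<in> E"
    then show "case e of (i,j) \<Rightarrow> i \<in> A x \<or> j \<in> A x \<or> i \<in> B x \<and> j \<in> B x" by (cases e) (simp add: edge)
  qed
qed

section \<open>Partitions into robust cells\<close>

definition mono_biclique :: "('v set \<Rightarrow> nat) \<Rightarrow> nat \<Rightarrow> nat \<Rightarrow> 'v set \<Rightarrow> 'v set \<Rightarrow> bool" where
  "mono_biclique \<phi> b l X Y \<longleftrightarrow> (\<exists>P Q. P \<subseteq> X \<and> Q \<subseteq> Y \<and> card P = b \<and> card Q = b \<and> P \<inter> Q = {} \<and>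
     (\<forall>p\<in>P. \<forall>q\<in>Q. \<phi> {p,q} = l))"

lemma mono_biclique_mono:
  "mono_biclique \<phi> b l X Y \<Longrightarrow> X \<subseteq> X' \<Longrightarrow> Y \<subseteq> Y' \<Longrightarrow> mono_biclique \<phi> b l X' Y'"
  unfolding mono_biclique_def by (smt (verit) subset_trans)

lemma mono_biclique_commute: "mono_biclique \<phi> b l X Y \<longleftrightarrow> mono_biclique \<phi> b l Y X"
proof -
  have "mono_biclique \<phi> b l Y X" if XY: "mono_biclique \<phi> b l X Y" for X Y
  proof -
    obtain P Q where "P \<subseteq> X" "Q \<subseteq> Y" "card P = b" "card Q = b" "P \<inter> Q = {}" "\<forall>p\<in>P. \<forall>q\<in>Q. \<phi> {p,q} = l"
      using XY unfolding mono_biclique_def by blast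
    moreover from this have "\<forall>q\<in>Q. \<forall>p\<in>P. \<phi> {q,p} = l" by (metis insert_commute)
    ultimately show ?thesis unfolding mono_biclique_def
      by - (rule exI[where x = Q], rule exI[where x = P], auto)
  qed
  then show ?thesis by blast
qed

lemma large_fibre:
  assumes "finite A" "finite B" "B \<noteq> {}" "f ` A \<subseteq> B" "k * card B \<le> card A"
  shows "\<exists>y\<in>B. k \<le> card {x\<in>A. f x = y}"
proof (rule ccontr)
  assume "\<not> ?thesis"
  then have lt: "\<And>y. y \<in> B \<Longrightarrow> card {x\<in>A. f x = y} < k" by auto
  have "A = (\<Union>y\<in>B. {x\<in>A. f x = y})" using assms(4) by auto
  then have "card A \<le> (\<Sum>y\<in>B. card {x\<in>A. f x = y})" using card_UN_le[OF assms(2)] by metis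
  also have "\<dots> < (\<Sum>y\<in>B. k)" using lt assms by (intro sum_strict_mono) auto
  finally show False using assms(5) by (simp add: mult.commute)
qed

text \<open>
  Fix \<open>rb\<close> vertices of \<open>Y\<close>. The remaining vertices of \<open>X\<close> are classified by their colour pattern on these,
  one of the at most \<open>r^(rb)\<close> patterns occurs at least \<open>b\<close> times, and within this pattern one colour
  appears at least \<open>b\<close> times. Taking the \<open>rb\<close> vertices out of \<open>X\<close> first makes the two sides
  disjoint even when \<open>X\<close> and \<open>Y\<close> overlap.
\<close>

lemma bipartite_pigeonhole:
  fixes \<phi> :: "'v set \<Rightarrow> nat"
  assumes fin: "finite X" "finite Y" and r: "1 \<le> r"
    and col: "\<And>x y. x \<in> X \<Longrightarrow> y \<in> Y \<Longrightarrow> x \<noteq> y \<Longrightarrow> \<phi> {x,y} \<in> {1..r}"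
    and big: "r * b + b * r ^ (r * b) \<le> card X" "r * b + b * r ^ (r * b) \<le> card Y"
  shows "\<exists>l\<in>{1..r}. mono_biclique \<phi> b l X Y"
proof -
  obtain Y' where Y': "Y' \<subseteq> Y" "card Y' = r * b" using obtain_subset_with_card_n[of "r * b" Y] big by auto
  have finY: "finite Y'" using Y' fin finite_subset by auto
  define X' where "X' = X - Y'"
  have finX: "finite X'" using fin by (simp add: X'_def)
  have "card X' \<ge> card X - card Y'" unfolding X'_def by (rule diff_card_le_card_Diff[OF finY])
  then have X': "b * r ^ (r * b) \<le> card X'" using big Y' by linarith
  let ?B = "Y' \<rightarrow>\<^sub>E {1..r}"
  let ?f = "\<lambda>x. \<lambda>y\<in>Y'. \<phi> {x,y}"
  have "card ?B = r ^ (r * b)" using Y' finY by (simp add: card_PiE)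
  moreover have "?f ` X' \<subseteq> ?B"
  proof (intro image_subsetI PiE_I)
    fix x y assume "x \<in> X'" "y \<in> Y'"
    then show "(\<lambda>y\<in>Y'. \<phi> {x,y}) y \<in> {1..r}" using col[of x y] Y' by (auto simp: X'_def)
  qed auto
  moreover have "?B \<noteq> {}" using r by (auto simp: PiE_eq_empty_iff)
  ultimately obtain g where g: "g \<in> ?B" "b \<le> card {x\<in>X'. ?f x = g}"
    using large_fibre[OF finX, of ?B ?f b] X' finY by (auto simp: finite_PiE)
  have "g ` Y' \<subseteq> {1..r}" using g(1) by (intro image_subsetI) (rule PiE_mem)
  then obtain l where l: "l \<in> {1..r}" "b \<le> card {y\<in>Y'. g y = l}"
    using large_fibre[OF finY, of "{1..r}" g b] Y' r by (auto simp: mult.commute)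
  obtain P where P: "P \<subseteq> {x\<in>X'. ?f x = g}" "card P = b" using obtain_subset_with_card_n[OF g(2)] by auto
  obtain Q where Q: "Q \<subseteq> {y\<in>Y'. g y = l}" "card Q = b" using obtain_subset_with_card_n[OF l(2)] by auto
  have "\<phi> {p,q} = l" if "p \<in> P" "q \<in> Q" for p q
  proof -
    have "?f p q = g q" "q \<in> Y'" "g q = l" using that P Q by auto
    then show ?thesis by simp
  qed
  then have "mono_biclique \<phi> b l X Y" unfolding mono_biclique_def using P Q Y'
    by (intro exI[of _ P] exI[of _ Q]) (auto simp: X'_def)
  then show ?thesis using l by blast
qed

definition cell :: "'v set \<Rightarrow> ('v \<Rightarrow> nat) \<Rightarrow> nat \<Rightarrow> 'v set" where
  "cell V f i = {v\<in>V. f v = i}"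

text \<open>
  No density is asked for: mere presence of the colour in every pair of large subsets is enough
  for greedy tiling.
\<close>

definition robust :: "('v set \<Rightarrow> nat) \<Rightarrow> nat \<Rightarrow> real \<Rightarrow> nat \<Rightarrow> 'v set \<Rightarrow> 'v set \<Rightarrow> bool" where
  "robust \<phi> b \<epsilon> l A B \<longleftrightarrow> (\<forall>X Y. X \<subseteq> A \<longrightarrow> Y \<subseteq> B \<longrightarrow> \<epsilon> * real (card A) \<le> real (card X) \<longrightarrow>
     \<epsilon> * real (card B) \<le> real (card Y) \<longrightarrow> mono_biclique \<phi> b l X Y)"

definition fickle :: "('v set \<Rightarrow> nat) \<Rightarrow> nat \<Rightarrow> nat \<Rightarrow> real \<Rightarrow> 'v set \<Rightarrow> 'v set \<Rightarrow> bool" where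
  "fickle \<phi> r b \<epsilon> A B \<longleftrightarrow> (\<exists>l\<in>{1..r}. mono_biclique \<phi> b l A B \<and> \<not> robust \<phi> b \<epsilon> l A B)"

text \<open>
  Pairs of vertices instead of pairs of cells are counted, which weights a pair of cells by the product
  of the sizes and lets partitions be compared over the fixed index set \<open>V \<times> V\<close>.
\<close>

definition fickle_pairs :: "('v set \<Rightarrow> nat) \<Rightarrow> nat \<Rightarrow> nat \<Rightarrow> real \<Rightarrow> 'v set \<Rightarrow> ('v \<Rightarrow> nat) \<Rightarrow> ('v \<times> 'v) set" where
  "fickle_pairs \<phi> r b \<epsilon> V f = {(u,v)\<in>V \<times> V. fickle \<phi> r b \<epsilon> (cell V f (f u)) (cell V f (f v))}"

text \<open>
  The potential of the refinement argument. Refining the partition can only decrease each summand.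
\<close>

definition colour_count :: "('v set \<Rightarrow> nat) \<Rightarrow> nat \<Rightarrow> nat \<Rightarrow> 'v set \<Rightarrow> ('v \<Rightarrow> nat) \<Rightarrow> nat" where
  "colour_count \<phi> r b V f = (\<Sum>(u,v)\<in>V \<times> V.
     card {l\<in>{1..r}. mono_biclique \<phi> b l (cell V f (f u)) (cell V f (f v))})"

lemma robust_commute: "robust \<phi> b \<epsilon> l A B \<longleftrightarrow> robust \<phi> b \<epsilon> l B A"
  unfolding robust_def by (metis mono_biclique_commute)

lemma card_pairs_by_labels:
  fixes f :: "'v \<Rightarrow> nat"
  assumes V: "finite V" and XY: "\<And>i j. X i j \<subseteq> cell V f i" "\<And>i j. Y i j \<subseteq> cell V f j"
  shows "card {(u,v)\<in>V \<times> V. R (f u) (f v) \<and> u \<in> X (f u) (f v) \<and> v \<in> Y (f u) (f v)}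
    = (\<Sum>(i,j)\<in>{(i,j)\<in>f ` V \<times> f ` V. R i j}. card (X i j) * card (Y i j))"
proof -
  let ?I = "{(i,j)\<in>f ` V \<times> f ` V. R i j}"
  have finI: "finite ?I" using V by (auto intro: finite_subset[of _ "f ` V \<times> f ` V"])
  have eq: "{(u,v)\<in>V \<times> V. R (f u) (f v) \<and> u \<in> X (f u) (f v) \<and> v \<in> Y (f u) (f v)}
      = (\<Union>(i,j)\<in>?I. X i j \<times> Y i j)" (is "?L = ?R")
  proof (intro equalityI subsetI)
    fix x assume "x \<in> ?L" then show "x \<in> ?R" by auto
  next
    fix x assume "x \<in> ?R"
    then obtain i j u v where *: "x = (u,v)" "R i j" "u \<in> X i j" "v \<in> Y i j" by auto
    then have "u \<in> V" "f u = i" "v \<in> V" "f v = j" using XY[of i j] by (auto simp: cell_def)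
    then show "x \<in> ?L" using * by auto
  qed
  have "card ?R = (\<Sum>p\<in>?I. card (case p of (i,j) \<Rightarrow> X i j \<times> Y i j))"
  proof (rule card_UN_disjoint[OF finI])
    have "finite (X i j)" "finite (Y i j)" for i j
      using XY[of i j] V by (auto simp: cell_def intro: finite_subset)
    then show "\<forall>p\<in>?I. finite (case p of (i,j) \<Rightarrow> X i j \<times> Y i j)" by auto
    have "X i j \<times> Y i j \<inter> X i' j' \<times> Y i' j' = {}" if "(i,j) \<noteq> (i',j')" for i j i' j'
      using that XY[of i j] XY[of i' j'] by (auto simp: cell_def)
    then show "\<forall>p\<in>?I. \<forall>q\<in>?I. p \<noteq> q \<longrightarrow>
       (case p of (i,j) \<Rightarrow> X i j \<times> Y i j) \<inter> (case q of (i,j) \<Rightarrow> X i j \<times> Y i j) = {}"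
      by (clarsimp simp only: split_paired_all case_prod_conv) blast
  qed
  then show ?thesis unfolding eq by (simp add: case_prod_unfold card_cartesian_product)
qed

text \<open>
  For each fickle pair of cells choose a colour that is present together with two large subsets
  between which it is absent, and refine every cell by all the chosen subsets. A pair of
  vertices in the chosen subsets then loses at least one colour, and these subsets contain an
  \<open>\<epsilon>\<^sup>2\<close> proportion of the pairs of vertices in the two cells.
\<close>

lemma refine_partition:
  fixes f :: "'v \<Rightarrow> nat" and \<phi> :: "'v set \<Rightarrow> nat"
  assumes V: "finite V" and K: "card (f ` V) \<le> K" and \<epsilon>: "0 \<le> \<epsilon>"
  shows "\<exists>f'::'v \<Rightarrow> nat. card (f' ` V) \<le> K * 4 ^ K \<and>
    real (colour_count \<phi> r b V f') + \<epsilon>\<^sup>2 * real (card (fickle_pairs \<phi> r b \<epsilon> V f)) \<le> real (colour_count \<phi> r b V f)"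
proof -
  let ?p = "cell V f"
  let ?I = "f ` V"
  have "\<forall>i j. \<exists>l X Y. fickle \<phi> r b \<epsilon> (?p i) (?p j) \<longrightarrow> l \<in> {1..r} \<and> mono_biclique \<phi> b l (?p i) (?p j) \<and>
      X \<subseteq> ?p i \<and> Y \<subseteq> ?p j \<and> \<epsilon> * card (?p i) \<le> card X \<and> \<epsilon> * card (?p j) \<le> card Y \<and> \<not> mono_biclique \<phi> b l X Y"
    unfolding fickle_def robust_def by blast
  then obtain l X0 Y0 where w: "\<And>i j. fickle \<phi> r b \<epsilon> (?p i) (?p j) \<Longrightarrow> l i j \<in> {1..r} \<and> mono_biclique \<phi> b (l i j) (?p i) (?p j) \<and>
      X0 i j \<subseteq> ?p i \<and> Y0 i j \<subseteq> ?p j \<and> \<epsilon> * card (?p i) \<le> card (X0 i j) \<and> \<epsilon> * card (?p j) \<le> card (Y0 i j)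
      \<and> \<not> mono_biclique \<phi> b (l i j) (X0 i j) (Y0 i j)"
    by metis
  define R where "R = (\<lambda>i j. fickle \<phi> r b \<epsilon> (?p i) (?p j))"
  define X where "X = (\<lambda>i j. if R i j then X0 i j else {})"
  define Y where "Y = (\<lambda>i j. if R i j then Y0 i j else {})"
  have XY: "X i j \<subseteq> ?p i" "Y i j \<subseteq> ?p j" for i j using w[of i j] by (auto simp: X_def Y_def R_def)
  \<comment> \<open>The new label of a vertex records its cell and the chosen subsets that contain it.\<close>
  define lab where "lab = (\<lambda>v. (f v, {j\<in>?I. v \<in> X (f v) j}, {i\<in>?I. v \<in> Y i (f v)}))"
  have finI: "finite ?I" using V by simp
  have "lab ` V \<subseteq> ?I \<times> Pow ?I \<times> Pow ?I" by (auto simp: lab_def)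
  then have "card (lab ` V) \<le> card (?I \<times> Pow ?I \<times> Pow ?I)" using finI by (intro card_mono) auto
  also have "\<dots> = card ?I * 4 ^ card ?I"
    using finI by (simp add: card_cartesian_product card_Pow power_mult_distrib[symmetric])
  also have "\<dots> \<le> K * 4 ^ K" using K by (intro mult_le_mono power_increasing) auto
  finally have cl: "card (lab ` V) \<le> K * 4 ^ K" .
  obtain h :: "nat \<times> nat set \<times> nat set \<Rightarrow> nat" where h: "inj_on h (lab ` V)"
    using finite_imp_inj_to_nat_seg[of "lab ` V"] V by auto
  define f' where "f' = h \<circ> lab"
  have f'V: "f' ` V = h ` (lab ` V)" by (simp add: f'_def image_comp)
  have same: "lab u = lab v" if "u \<in> V" "v \<in> V" "f' u = f' v" for u v
    using that h by (auto simp: f'_def dest: inj_onD)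
  let ?q = "cell V f'"
  have sub: "?q (f' u) \<subseteq> ?p (f u)" if "u \<in> V" for u
    using same[OF _ that] by (auto simp: cell_def lab_def)
  have subX: "?q (f' u) \<subseteq> X (f u) j" if "u \<in> V" "j \<in> ?I" "u \<in> X (f u) j" for u j
  proof
    fix x assume "x \<in> ?q (f' u)"
    then have "lab x = lab u" using same[of x u] that by (auto simp: cell_def)
    then have "f x = f u" "{j\<in>?I. x \<in> X (f x) j} = {j\<in>?I. u \<in> X (f u) j}" by (auto simp: lab_def)
    then show "x \<in> X (f u) j" using that by auto
  qed
  have subY: "?q (f' v) \<subseteq> Y i (f v)" if "v \<in> V" "i \<in> ?I" "v \<in> Y i (f v)" for v i
  proof
    fix x assume "x \<in> ?q (f' v)"
    then have "lab x = lab v" using same[of x v] that by (auto simp: cell_def)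
    then have "f x = f v" "{i\<in>?I. x \<in> Y i (f x)} = {i\<in>?I. v \<in> Y i (f v)}" by (auto simp: lab_def)
    then show "x \<in> Y i (f v)" using that by auto
  qed
  define S where "S = {(u,v)\<in>V \<times> V. R (f u) (f v) \<and> u \<in> X (f u) (f v) \<and> v \<in> Y (f u) (f v)}"
  let ?c = "\<lambda>g (u,v). card {l\<in>{1..r}. mono_biclique \<phi> b l (cell V g (g u)) (cell V g (g v))}"
  have point: "?c f' x + (if x \<in> S then 1 else 0) \<le> ?c f x" if xV: "x \<in> V \<times> V" for x
  proof -
    obtain u v where x: "x = (u,v)" "u \<in> V" "v \<in> V" using xV by auto
    let ?L = "\<lambda>g. {l\<in>{1..r}. mono_biclique \<phi> b l (cell V g (g u)) (cell V g (g v))}"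
    have LL: "?L f' \<subseteq> ?L f" using sub[OF x(2)] sub[OF x(3)] by (auto intro: mono_biclique_mono)
    show ?thesis
    proof (cases "x \<in> S")
      case True
      let ?l = "l (f u) (f v)"
      have R: "R (f u) (f v)" and uX: "u \<in> X (f u) (f v)" and vY: "v \<in> Y (f u) (f v)"
        using True x by (auto simp: S_def)
      have w': "?l \<in> ?L f" "\<not> mono_biclique \<phi> b ?l (X (f u) (f v)) (Y (f u) (f v))"
        using w[of "f u" "f v"] R by (auto simp: R_def X_def Y_def)
      then have "?l \<notin> ?L f'"
        using mono_biclique_mono[OF _ subX[OF x(2) imageI[OF x(3)] uX] subY[OF x(3) imageI[OF x(2)] vY]] by auto
      then have "?L f' \<subset> ?L f" using LL w' by auto
      then have "card (?L f') < card (?L f)" by (intro psubset_card_mono) auto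
      then show ?thesis using True x by simp
    next
      case False
      then show ?thesis using card_mono[OF _ LL] x by simp
    qed
  qed
  have finS: "S \<subseteq> V \<times> V" by (auto simp: S_def)
  have "colour_count \<phi> r b V f' + card S = (\<Sum>x\<in>V \<times> V. ?c f' x + (if x \<in> S then 1 else 0))"
    using V finS by (simp add: colour_count_def sum.distrib sum.If_cases Int_absorb1)
  also have "\<dots> \<le> colour_count \<phi> r b V f" unfolding colour_count_def by (rule sum_mono[OF point])
  finally have drop: "colour_count \<phi> r b V f' + card S \<le> colour_count \<phi> r b V f" .
  let ?J = "{(i,j)\<in>?I \<times> ?I. R i j}"
  have cS: "card S = (\<Sum>(i,j)\<in>?J. card (X i j) * card (Y i j))"
    unfolding S_def by (rule card_pairs_by_labels[OF V XY])
  have "fickle_pairs \<phi> r b \<epsilon> V f = {(u,v)\<in>V \<times> V. R (f u) (f v) \<and> u \<in> ?p (f u) \<and> v \<in> ?p (f v)}"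
    by (auto simp: fickle_pairs_def R_def cell_def)
  then have cF: "card (fickle_pairs \<phi> r b \<epsilon> V f) = (\<Sum>(i,j)\<in>?J. card (?p i) * card (?p j))"
    using card_pairs_by_labels[OF V, of "\<lambda>i j. ?p i" f "\<lambda>i j. ?p j" R] by auto
  have "\<epsilon>\<^sup>2 * real (card (fickle_pairs \<phi> r b \<epsilon> V f)) = (\<Sum>(i,j)\<in>?J. (\<epsilon> * card (?p i)) * (\<epsilon> * card (?p j)))"
    unfolding cF by (simp add: sum_distrib_left case_prod_unfold power2_eq_square algebra_simps)
  also have "\<dots> \<le> (\<Sum>(i,j)\<in>?J. real (card (X i j)) * real (card (Y i j)))"
  proof (rule sum_mono, clarify)
    fix i j assume "R i j"
    then show "(\<epsilon> * card (?p i)) * (\<epsilon> * card (?p j)) \<le> real (card (X i j)) * real (card (Y i j))"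
      using w[of i j] \<epsilon> by (intro mult_mono) (auto simp: R_def X_def Y_def)
  qed
  also have "\<dots> = real (card S)" unfolding cS by (simp add: case_prod_unfold)
  finally have "\<epsilon>\<^sup>2 * real (card (fickle_pairs \<phi> r b \<epsilon> V f)) \<le> real (card S)" .
  moreover have "card (f' ` V) \<le> K * 4 ^ K"
    unfolding f'V using card_image_le[of "lab ` V" h] V cl by simp
  ultimately show ?thesis using drop by (intro exI[of _ f']) linarith
qed

lemma colour_count_le:
  assumes "finite V"
  shows "colour_count \<phi> r b V f \<le> r * (card V)\<^sup>2"
proof -
  have "colour_count \<phi> r b V f \<le> (\<Sum>x\<in>V \<times> V. r)"
    unfolding colour_count_def
  proof (rule sum_mono, clarify)
    fix u v
    have "card {l\<in>{1..r}. mono_biclique \<phi> b l (cell V f (f u)) (cell V f (f v))} \<le> card {1..r}"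
      by (intro card_mono) auto
    then show "card {l\<in>{1..r}. mono_biclique \<phi> b l (cell V f (f u)) (cell V f (f v))} \<le> r" by simp
  qed
  then show ?thesis by (simp add: card_cartesian_product power2_eq_square mult.commute)
qed

text \<open>
  The potential starts at no more than \<open>r |V|\<^sup>2\<close> and drops by more than \<open>\<epsilon>\<^sup>2 \<delta> |V|\<^sup>2\<close> with every refinement of a
  partition with too many fickle pairs, so a bounded number of refinements suffices.
\<close>

lemma robust_partition:
  fixes \<epsilon> \<delta> :: real
  assumes "0 < \<epsilon>" "0 < \<delta>"
  shows "\<exists>K. \<forall>\<phi>::'v set \<Rightarrow> nat. \<forall>V. finite V \<longrightarrow> (\<exists>f::'v \<Rightarrow> nat. card (f ` V) \<le> K \<and>
    real (card (fickle_pairs \<phi> r b \<epsilon> V f)) \<le> \<delta> * (real (card V))\<^sup>2)"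
proof -
  have step: "\<exists>K. \<forall>\<phi>::'v set \<Rightarrow> nat. \<forall>V. finite V \<longrightarrow> (\<exists>f::'v \<Rightarrow> nat. card (f ` V) \<le> K \<and>
    (real (card (fickle_pairs \<phi> r b \<epsilon> V f)) \<le> \<delta> * (real (card V))\<^sup>2 \<or>
     real (colour_count \<phi> r b V f) + real m * (\<epsilon>\<^sup>2 * \<delta> * (real (card V))\<^sup>2) \<le> real r * (real (card V))\<^sup>2))" for m
  proof (induction m)
    case 0
    show ?case
    proof (intro exI[of _ 1] allI impI exI[of _ "\<lambda>_. 0"] conjI disjI2)
      fix \<phi> :: "'v set \<Rightarrow> nat" and V :: "'v set" assume V: "finite V"
      show "card ((\<lambda>_. 0::nat) ` V) \<le> 1" by (simp add: image_constant_conv)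
      show "real (colour_count \<phi> r b V (\<lambda>_. 0)) + real 0 * (\<epsilon>\<^sup>2 * \<delta> * (real (card V))\<^sup>2) \<le> real r * (real (card V))\<^sup>2"
        using colour_count_le[OF V, of \<phi> r b "\<lambda>_. 0"] by (metis add.right_neutral mult_zero_left of_nat_0 of_nat_le_iff of_nat_mult of_nat_power)
    qed
  next
    case (Suc m)
    then obtain K where K: "\<And>(\<phi>::'v set \<Rightarrow> nat) V. finite V \<Longrightarrow> (\<exists>f::'v \<Rightarrow> nat. card (f ` V) \<le> K \<and>
     (real (card (fickle_pairs \<phi> r b \<epsilon> V f)) \<le> \<delta> * (real (card V))\<^sup>2 \<or>
     real (colour_count \<phi> r b V f) + real m * (\<epsilon>\<^sup>2 * \<delta> * (real (card V))\<^sup>2) \<le> real r * (real (card V))\<^sup>2))"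
      by blast
    show ?case
    proof (intro exI[of _ "K * 4 ^ K"] allI impI)
      fix \<phi> :: "'v set \<Rightarrow> nat" and V :: "'v set" assume V: "finite V"
      from K[OF V, of \<phi>] obtain f where f: "card (f ` V) \<le> K"
        "real (card (fickle_pairs \<phi> r b \<epsilon> V f)) \<le> \<delta> * (real (card V))\<^sup>2 \<or>
         real (colour_count \<phi> r b V f) + real m * (\<epsilon>\<^sup>2 * \<delta> * (real (card V))\<^sup>2) \<le> real r * (real (card V))\<^sup>2" by blast
      show "\<exists>f. card (f ` V) \<le> K * 4 ^ K \<and>
         (real (card (fickle_pairs \<phi> r b \<epsilon> V f)) \<le> \<delta> * (real (card V))\<^sup>2 \<or>
          real (colour_count \<phi> r b V f) + real (Suc m) * (\<epsilon>\<^sup>2 * \<delta> * (real (card V))\<^sup>2) \<le> real r * (real (card V))\<^sup>2)"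
      proof (cases "real (card (fickle_pairs \<phi> r b \<epsilon> V f)) \<le> \<delta> * (real (card V))\<^sup>2")
        case True
        have "card (f ` V) \<le> K * 4 ^ K" by (rule le_trans[OF f(1)]) simp
        then show ?thesis using True by blast
      next
        case False
        obtain f' where f': "card (f' ` V) \<le> K * 4 ^ K"
          "real (colour_count \<phi> r b V f') + \<epsilon>\<^sup>2 * real (card (fickle_pairs \<phi> r b \<epsilon> V f)) \<le> real (colour_count \<phi> r b V f)"
          using refine_partition[OF V f(1), of \<epsilon> \<phi> r b] assms by auto
        have "\<epsilon>\<^sup>2 * (\<delta> * (real (card V))\<^sup>2) \<le> \<epsilon>\<^sup>2 * real (card (fickle_pairs \<phi> r b \<epsilon> V f))"
          using False by (intro mult_left_mono) auto
        then show ?thesis using f' f(2) False by (intro exI[of _ f']) (simp add: algebra_simps)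
      qed
    qed
  qed
  \<comment> \<open>After this many refinements the potential would be negative.\<close>
  obtain m where m: "real r < real m * (\<epsilon>\<^sup>2 * \<delta>)"
    using reals_Archimedean3[of "\<epsilon>\<^sup>2 * \<delta>"] assms by auto
  from step[of m] obtain K where K: "\<And>(\<phi>::'v set \<Rightarrow> nat) V. finite V \<Longrightarrow> (\<exists>f::'v \<Rightarrow> nat. card (f ` V) \<le> K \<and>
     (real (card (fickle_pairs \<phi> r b \<epsilon> V f)) \<le> \<delta> * (real (card V))\<^sup>2 \<or>
     real (colour_count \<phi> r b V f) + real m * (\<epsilon>\<^sup>2 * \<delta> * (real (card V))\<^sup>2) \<le> real r * (real (card V))\<^sup>2))"
    by blast
  show ?thesis
  proof (intro exI[of _ K] allI impI)
    fix \<phi> :: "'v set \<Rightarrow> nat" and V :: "'v set" assume V: "finite V"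
    from K[OF V, of \<phi>] obtain f where f: "card (f ` V) \<le> K"
        "real (card (fickle_pairs \<phi> r b \<epsilon> V f)) \<le> \<delta> * (real (card V))\<^sup>2 \<or>
         real (colour_count \<phi> r b V f) + real m * (\<epsilon>\<^sup>2 * \<delta> * (real (card V))\<^sup>2) \<le> real r * (real (card V))\<^sup>2" by blast
    have "real (card (fickle_pairs \<phi> r b \<epsilon> V f)) \<le> \<delta> * (real (card V))\<^sup>2"
    proof (cases "V = {}")
      case True then show ?thesis by (simp add: fickle_pairs_def)
    next
      case False
      then have "0 < (real (card V))\<^sup>2" using V by (simp add: card_gt_0_iff)
      then have "real r * (real (card V))\<^sup>2 < real m * (\<epsilon>\<^sup>2 * \<delta>) * (real (card V))\<^sup>2" using m by simp
      then show ?thesis using f(2) by (simp add: algebra_simps)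
    qed
    then show "\<exists>f. card (f ` V) \<le> K \<and> real (card (fickle_pairs \<phi> r b \<epsilon> V f)) \<le> \<delta> * (real (card V))\<^sup>2"
      using f by blast
  qed
qed

section \<open>Tilings and the tiling number\<close>

text \<open>
  A tiling is recorded only through its size and its set of covered vertices, since this is all that a
  greedy choice of further copies depends on.
\<close>

inductive tiled :: "('v set \<Rightarrow> nat) \<Rightarrow> nat \<Rightarrow> nat \<Rightarrow> nat \<Rightarrow> nat \<Rightarrow> 'v set \<Rightarrow> bool" for \<phi> a b l where
  empty: "tiled \<phi> a b l 0 {}"
| add: "tiled \<phi> a b l m U \<Longrightarrow> card P = a \<Longrightarrow> card Q = b \<Longrightarrow> P \<inter> Q = {} \<Longrightarrow> (P \<union> Q) \<inter> U = {} \<Longrightarrow>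
    (\<And>p q. p \<in> P \<Longrightarrow> q \<in> Q \<Longrightarrow> \<phi> {p,q} = l) \<Longrightarrow> tiled \<phi> a b l (Suc m) (U \<union> (P \<union> Q))"

lemma complete_bipartite_copy:
  assumes P: "card P = a" "finite P" and Q: "card Q = b" "finite Q" and d: "P \<inter> Q = {}"
  shows "graph_iso (complete_bipartite_graph a b) (P \<union> Q, {{p,q} |p q. p \<in> P \<and> q \<in> Q})"
proof -
  obtain f where f: "bij_betw f {..<a} P"
    using ex_bij_betw_nat_finite[OF P(2)] P(1) by (auto simp: atLeast0LessThan)
  obtain g where g: "bij_betw g {..<b} Q"
    using ex_bij_betw_nat_finite[OF Q(2)] Q(1) by (auto simp: atLeast0LessThan)
  define h where "h = case_sum f g"
  have im: "f ` {..<a} = P" "g ` {..<b} = Q" using f g by (auto simp: bij_betw_def)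
  have "bij_betw h ({..<a} <+> {..<b}) (P \<union> Q)"
    unfolding bij_betw_def
  proof
    show "inj_on h ({..<a} <+> {..<b})"
      using f g d im by (auto simp: inj_on_def h_def bij_betw_def split: sum.splits)
    show "h ` ({..<a} <+> {..<b}) = P \<union> Q"
      using im by (auto simp: h_def Plus_def image_Un image_image)
  qed
  moreover have "{{p,q} |p q. p \<in> P \<and> q \<in> Q} = (\<lambda>e. h ` e) ` {{Inl i, Inr j} |i j. i < a \<and> j < b}"
  proof (intro equalityI subsetI)
    fix e assume "e \<in> {{p,q} |p q. p \<in> P \<and> q \<in> Q}"
    then obtain i j where "e = {f i, g j}" "i < a" "j < b" using im by auto
    then have "e = h ` {Inl i, Inr j}" "{Inl i, Inr j} \<in> {{Inl i, Inr j} |i j. i < a \<and> j < b}"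
      by (auto simp: h_def)
    then show "e \<in> (\<lambda>e. h ` e) ` {{Inl i, Inr j} |i j. i < a \<and> j < b}" by blast
  next
    fix e assume "e \<in> (\<lambda>e. h ` e) ` {{Inl i, Inr j} |i j. i < a \<and> j < b}"
    then obtain i j where "e = {f i, g j}" "i < a" "j < b" by (auto simp: h_def)
    then show "e \<in> {{p,q} |p q. p \<in> P \<and> q \<in> Q}" using im by auto
  qed
  ultimately show ?thesis unfolding graph_iso_def complete_bipartite_graph_def by (intro exI[of _ h]) simp
qed

lemma tiled_packing:
  assumes "tiled \<phi> a b l m U" "1 \<le> a" "1 \<le> b" "U \<subseteq> {..<n}"
  shows "\<exists>\<P>\<in>mono_packings (complete_bipartite_graph a b) (complete_graph n) \<phi> l.
    finite \<P> \<and> card \<P> = m \<and> (\<forall>F\<in>\<P>. verts F \<subseteq> U)"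
  using assms
proof (induction rule: tiled.induct)
  case empty
  show ?case by (intro bexI[of _ "{}"]) (auto simp: mono_packings_def)
next
  case (add m U P Q)
  let ?F = "(P \<union> Q, {{p,q} |p q. p \<in> P \<and> q \<in> Q})"
  obtain \<P> where \<P>: "\<P> \<in> mono_packings (complete_bipartite_graph a b) (complete_graph n) \<phi> l"
    "finite \<P>" "card \<P> = m" "\<forall>F\<in>\<P>. verts F \<subseteq> U" using add by auto
  have fin: "finite P" "finite Q" using add.hyps(2,3) add.prems(1,2) by (metis card.infinite not_one_le_zero)+
  have PQ: "P \<union> Q \<subseteq> {..<n}" using add.prems by auto
  have "card {p,q} = 2" if "p \<in> P" "q \<in> Q" for p q
  proof -
    have "p \<noteq> q" using that add.hyps(4) by auto
    then show ?thesis by simp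
  qed
  then have "subgraph ?F (complete_graph n)" using PQ by (auto simp: subgraph_def complete_graph_def)
  then have F: "?F \<in> mono_copies (complete_bipartite_graph a b) (complete_graph n) \<phi> l"
    using complete_bipartite_copy[OF add.hyps(2) fin(1) add.hyps(3) fin(2) add.hyps(4)] add.hyps(6)
    by (auto simp: mono_copies_def)
  have ne: "P \<noteq> {}" using add.hyps(2) add.prems(1) by auto
  have disj: "verts F \<inter> (P \<union> Q) = {}" if "F \<in> \<P>" for F using that \<P>(4) add.hyps(5) by blast
  then have "?F \<notin> \<P>" using ne by fastforce
  moreover have "insert ?F \<P> \<in> mono_packings (complete_bipartite_graph a b) (complete_graph n) \<phi> l"
    using \<P>(1) F disj unfolding mono_packings_def by (auto simp: pairwise_insert Int_commute)
  ultimately show ?case using \<P> by (intro bexI[of _ "insert ?F \<P>"]) auto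
qed

lemma finite_mono_copies:
  assumes "finite (verts G)" "finite (edges G)"
  shows "finite (mono_copies H G \<phi> l)"
proof (rule finite_subset)
  show "mono_copies H G \<phi> l \<subseteq> Pow (verts G) \<times> Pow (edges G)"
    by (auto simp: mono_copies_def subgraph_def)
qed (use assms in auto)

lemma finite_mono_packings:
  assumes "finite (verts G)" "finite (edges G)"
  shows "finite (mono_packings H G \<phi> l)"
  by (rule finite_subset[of _ "Pow (mono_copies H G \<phi> l)"])
     (use finite_mono_copies[OF assms, of H] in \<open>auto simp: mono_packings_def\<close>)

lemma finite_complete_graph: "finite (verts (complete_graph n))" "finite (edges (complete_graph n))"
  by (auto simp: complete_graph_def intro: finite_subset[of _ "Pow {..<n}"])

lemma tiling_number_ge:
  assumes "finite (verts G)" "finite (edges G)" "\<P> \<in> mono_packings H G \<phi> l" "l \<in> {1..r}"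
  shows "card \<P> \<le> tiling_number r H G \<phi>"
proof -
  have "card \<P> \<le> Max (card ` mono_packings H G \<phi> l)"
    using finite_mono_packings[OF assms(1,2), of H] assms(3) by (intro Max_ge) auto
  also have "\<dots> \<le> tiling_number r H G \<phi>"
    unfolding tiling_number_def using assms(4) by (intro Max_ge) auto
  finally show ?thesis .
qed

lemma tiling_number_le:
  assumes G: "finite (verts G)" "finite (edges G)" and r: "1 \<le> r"
    and le: "\<And>l \<P>. l \<in> {1..r} \<Longrightarrow> \<P> \<in> mono_packings H G \<phi> l \<Longrightarrow> card \<P> \<le> k"
  shows "tiling_number r H G \<phi> \<le> k"
proof -
  have "{} \<in> mono_packings H G \<phi> l" for l by (simp add: mono_packings_def)
  then have ne: "mono_packings H G \<phi> l \<noteq> {}" for l by auto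
  show ?thesis unfolding tiling_number_def
    using le finite_mono_packings[OF G, of H] ne r by (intro Max.boundedI) auto
qed

lemma finite_colourings: "finite (edges G) \<Longrightarrow> finite (edges G \<rightarrow>\<^sub>E {1..r::nat})"
  by (intro finite_PiE) auto

lemma Rt_le:
  assumes "finite (edges G)" "\<phi> \<in> edges G \<rightarrow>\<^sub>E {1..r}"
  shows "Rt r H G \<le> tiling_number r H G \<phi>"
  unfolding Rt_def using assms finite_colourings[OF assms(1), of r] by (intro Min_le) auto

lemma Rt_attained:
  assumes "finite (edges G)" "1 \<le> r"
  obtains \<phi> where "\<phi> \<in> edges G \<rightarrow>\<^sub>E {1..r}" "Rt r H G = tiling_number r H G \<phi>"
proof -
  have "edges G \<rightarrow>\<^sub>E {1..r} \<noteq> {}" using assms(2) by (auto simp: PiE_eq_empty_iff)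
  then have "Rt r H G \<in> tiling_number r H G ` (edges G \<rightarrow>\<^sub>E {1..r})"
    unfolding Rt_def using finite_colourings[OF assms(1), of r] by (intro Min_in) auto
  then show ?thesis using that by auto
qed

section \<open>Tilings from fractional tilings\<close>

text \<open>
  How many vertices a tile with its \<open>a\<close>-side in cell \<open>fst e\<close> and its \<open>b\<close>-side in cell \<open>snd e\<close> takes from
  cell \<open>i\<close>; the two cells may coincide.
\<close>

definition usage :: "nat \<Rightarrow> nat \<Rightarrow> nat \<times> nat \<Rightarrow> nat \<Rightarrow> nat" where
  "usage a b e i = (if fst e = i then a else 0) + (if snd e = i then b else 0)"

text \<open>
  The tiles are chosen one at a time. As long as the plan \<open>m\<close> uses at most a \<open>1-\<epsilon>\<close> proportion of each cell,
  the unused parts of the two cells of the next tile still have proportion \<open>\<epsilon>\<close>, and robustness supplies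
  the tile.
\<close>

lemma robust_tiling:
  fixes f :: "'v \<Rightarrow> nat" and m :: "nat \<times> nat \<Rightarrow> nat"
  assumes V: "finite V" and ab: "a \<le> b" and E: "finite E"
    and rob: "\<And>i j. (i,j) \<in> E \<Longrightarrow> robust \<phi> b \<epsilon> l (cell V f i) (cell V f j)"
    and load: "\<And>i. real (\<Sum>e\<in>E. m e * usage a b e i) \<le> (1 - \<epsilon>) * real (card (cell V f i))"
  shows "\<exists>U. tiled \<phi> a b l (\<Sum>e\<in>E. m e) U \<and> U \<subseteq> V \<and>
    (\<forall>i. card (U \<inter> cell V f i) \<le> (\<Sum>e\<in>E. m e * usage a b e i))"
  using load
proof (induction "\<Sum>e\<in>E. m e" arbitrary: m)
  case 0
  then show ?case by (intro exI[of _ "{}"]) (auto intro: tiled.empty)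
next
  case (Suc N)
  then have "\<exists>e\<in>E. m e \<noteq> 0" by (metis nat.distinct(1) sum.neutral)
  then obtain i j where ij: "(i,j) \<in> E" "m (i,j) \<noteq> 0" by auto
  define m' where "m' = m((i,j) := m (i,j) - 1)"
  have split: "(\<Sum>e\<in>E. g e (m e)) = g (i,j) (m (i,j)) + (\<Sum>e\<in>E - {(i,j)}. g e (m e))"
    "(\<Sum>e\<in>E. g e (m' e)) = g (i,j) (m (i,j) - 1) + (\<Sum>e\<in>E - {(i,j)}. g e (m e))" for g :: "nat \<times> nat \<Rightarrow> nat \<Rightarrow> nat"
  proof -
    have "(\<Sum>e\<in>E - {(i,j)}. g e (m' e)) = (\<Sum>e\<in>E - {(i,j)}. g e (m e))"
      by (rule sum.cong) (auto simp: m'_def)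
    then show "(\<Sum>e\<in>E. g e (m' e)) = g (i,j) (m (i,j) - 1) + (\<Sum>e\<in>E - {(i,j)}. g e (m e))"
      by (simp add: sum.remove[OF E ij(1)] m'_def)
  qed (rule sum.remove[OF E ij(1)])
  have N: "N = (\<Sum>e\<in>E. m' e)" using split(1)[of "\<lambda>e x. x"] split(2)[of "\<lambda>e x. x"] Suc(2) ij by simp
  have ld: "(\<Sum>e\<in>E. m e * usage a b e k) = (\<Sum>e\<in>E. m' e * usage a b e k) + usage a b (i,j) k" for k
  proof -
    have "m (i,j) * usage a b (i,j) k = (m (i,j) - 1) * usage a b (i,j) k + usage a b (i,j) k"
      using ij(2) by (cases "m (i,j)") auto
    then show ?thesis
      using split(1)[of "\<lambda>e x. x * usage a b e k"] split(2)[of "\<lambda>e x. x * usage a b e k"] by simp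
  qed
  have "real (\<Sum>e\<in>E. m' e * usage a b e k) \<le> (1 - \<epsilon>) * real (card (cell V f k))" for k
    using Suc(3)[of k] ld[of k] by linarith
  from Suc(1)[OF N this] obtain U where U: "tiled \<phi> a b l N U" "U \<subseteq> V"
     "\<And>k. card (U \<inter> cell V f k) \<le> (\<Sum>e\<in>E. m' e * usage a b e k)" unfolding N by blast
  have finp: "finite (cell V f k)" for k using V by (simp add: cell_def)
  have free: "\<epsilon> * real (card (cell V f k)) \<le> real (card (cell V f k - U))" for k
  proof -
    have "card (cell V f k) = card (cell V f k - U) + card (U \<inter> cell V f k)"
      using card_Int_Diff[OF finp[of k], of U] by (simp add: Int_commute)
    moreover have "real (card (U \<inter> cell V f k)) \<le> (1 - \<epsilon>) * real (card (cell V f k))"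
      using U(3)[of k] Suc(3)[of k] ld[of k] by linarith
    ultimately show ?thesis by (simp add: algebra_simps)
  qed
  from rob[OF ij(1)] free[of i] free[of j]
  have "mono_biclique \<phi> b l (cell V f i - U) (cell V f j - U)" unfolding robust_def by blast
  then obtain P0 Q where PQ: "P0 \<subseteq> cell V f i - U" "Q \<subseteq> cell V f j - U" "card P0 = b" "card Q = b" "P0 \<inter> Q = {}"
    "\<forall>p\<in>P0. \<forall>q\<in>Q. \<phi> {p,q} = l" unfolding mono_biclique_def by blast
  obtain P where P: "P \<subseteq> P0" "card P = a" using obtain_subset_with_card_n[of a P0] PQ ab by auto
  have t: "tiled \<phi> a b l (Suc N) (U \<union> (P \<union> Q))"
    by (rule tiled.add[OF U(1) P(2) PQ(4)]) (use P PQ in auto)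
  have "card ((U \<union> (P \<union> Q)) \<inter> cell V f k) \<le> (\<Sum>e\<in>E. m e * usage a b e k)" for k
  proof -
    have "card (P \<inter> cell V f k) \<le> (if i = k then a else 0)"
    proof (cases "i = k")
      case True
      have "finite P" by (rule finite_subset[OF _ finp[of i]]) (use P PQ in auto)
      then have "card (P \<inter> cell V f k) \<le> card P" by (intro card_mono) auto
      then show ?thesis using True P(2) by simp
    next
      case False
      then have "P \<inter> cell V f k = {}" using P PQ by (auto simp: cell_def)
      then show ?thesis by simp
    qed
    moreover have "card (Q \<inter> cell V f k) \<le> (if j = k then b else 0)"
    proof (cases "j = k")
      case True
      have "finite Q" by (rule finite_subset[OF _ finp[of j]]) (use PQ in auto)
      then have "card (Q \<inter> cell V f k) \<le> card Q" by (intro card_mono) auto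
      then show ?thesis using True PQ(4) by simp
    next
      case False
      then have "Q \<inter> cell V f k = {}" using PQ by (auto simp: cell_def)
      then show ?thesis by simp
    qed
    moreover have "card ((U \<union> (P \<union> Q)) \<inter> cell V f k)
       \<le> card (U \<inter> cell V f k) + (card (P \<inter> cell V f k) + card (Q \<inter> cell V f k))"
      unfolding Int_Un_distrib2 by (meson add_left_mono card_Un_le le_trans)
    ultimately show ?thesis using U(3)[of k] ld[of k] by (simp add: usage_def)
  qed
  moreover have "U \<union> (P \<union> Q) \<subseteq> V" using U P PQ by (auto simp: cell_def)
  ultimately show ?case using t Suc(2) by (intro exI[of _ "U \<union> (P \<union> Q)"]) simp
qed

text \<open>
  The factor \<open>1-\<epsilon>\<close> leaves room in every cell for the greedy choice, and rounding down loses at most one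
  tile for each pair of cells.
\<close>

lemma fractional_tiling_realised:
  fixes f :: "'v \<Rightarrow> nat" and w :: "nat \<times> nat \<Rightarrow> real"
  assumes V: "finite V" and ab: "a \<le> b" and \<epsilon>: "0 \<le> \<epsilon>" "\<epsilon> \<le> 1"
    and E: "E \<subseteq> f ` V \<times> f ` V"
    and rob: "\<And>i j. (i,j) \<in> E \<Longrightarrow> robust \<phi> b \<epsilon> l (cell V f i) (cell V f j)"
    and w: "\<And>e. e \<in> E \<Longrightarrow> 0 \<le> w e"
    and load: "\<And>i. i \<in> f ` V \<Longrightarrow> (\<Sum>e\<in>E. real (usage a b e i) * w e) \<le> card (cell V f i)"
  shows "\<exists>m U. tiled \<phi> a b l m U \<and> U \<subseteq> V \<and> (1 - \<epsilon>) * (\<Sum>e\<in>E. w e) - real (card (f ` V) ^ 2) \<le> real m"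
proof -
  have finE: "finite E" by (rule finite_subset[OF E]) (use V in simp)
  define m where "m = (\<lambda>e. nat \<lfloor>(1 - \<epsilon>) * w e\<rfloor>)"
  have m: "real (m e) \<le> (1 - \<epsilon>) * w e" "(1 - \<epsilon>) * w e - 1 \<le> real (m e)" if "e \<in> E" for e
  proof -
    have "0 \<le> (1 - \<epsilon>) * w e" using w[OF that] \<epsilon> by simp
    then show "real (m e) \<le> (1 - \<epsilon>) * w e" "(1 - \<epsilon>) * w e - 1 \<le> real (m e)" unfolding m_def by linarith+
  qed
  have "real (\<Sum>e\<in>E. m e * usage a b e i) \<le> (1 - \<epsilon>) * real (card (cell V f i))" for i
  proof (cases "i \<in> f ` V")
    case True
    have "real (\<Sum>e\<in>E. m e * usage a b e i) \<le> (\<Sum>e\<in>E. (1 - \<epsilon>) * w e * real (usage a b e i))"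
      unfolding of_nat_sum of_nat_mult using m by (intro sum_mono mult_right_mono) auto
    also have "\<dots> = (1 - \<epsilon>) * (\<Sum>e\<in>E. real (usage a b e i) * w e)"
      by (simp add: sum_distrib_left algebra_simps)
    also have "\<dots> \<le> (1 - \<epsilon>) * real (card (cell V f i))"
      using load[OF True] \<epsilon> by (intro mult_left_mono) auto
    finally show ?thesis .
  next
    case False
    then have "usage a b e i = 0" if "e \<in> E" for e using that E by (auto simp: usage_def)
    then show ?thesis using \<epsilon> by simp
  qed
  from robust_tiling[OF V ab finE rob this]
  obtain U where U: "tiled \<phi> a b l (\<Sum>e\<in>E. m e) U" "U \<subseteq> V" by blast
  have "card E \<le> card (f ` V \<times> f ` V)" using E V by (intro card_mono) auto
  then have cE: "card E \<le> card (f ` V) ^ 2" by (simp add: card_cartesian_product power2_eq_square)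
  have "(1 - \<epsilon>) * (\<Sum>e\<in>E. w e) - real (card E) = (\<Sum>e\<in>E. (1 - \<epsilon>) * w e - 1)"
    by (simp add: sum_distrib_left sum_subtractf)
  also have "\<dots> \<le> real (\<Sum>e\<in>E. m e)" unfolding of_nat_sum using m by (intro sum_mono) auto
  finally have "(1 - \<epsilon>) * (\<Sum>e\<in>E. w e) - real (card (f ` V) ^ 2) \<le> real (\<Sum>e\<in>E. m e)"
    using cE by linarith
  then show ?thesis using U by blast
qed

text \<open>
  Duality on the level of cells, with an edge for each robust pair, translated back to vertices.
\<close>

lemma tiling_or_cover:
  fixes f :: "'v \<Rightarrow> nat"
  assumes V: "finite V" and ab: "1 \<le> a" "a \<le> b" and \<epsilon>: "0 \<le> \<epsilon>" "\<epsilon> \<le> 1"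
  shows "(\<exists>m U. tiled \<phi> a b l m U \<and> U \<subseteq> V \<and> (1 - \<epsilon>) * \<theta> - real (card (f ` V) ^ 2) \<le> real m) \<or>
   (\<exists>A B. A \<subseteq> V \<and> B \<subseteq> V \<and> real (card A) / real a + real (card B) / real (a + b) < \<theta> \<and>
     (\<forall>u\<in>V. \<forall>v\<in>V. robust \<phi> b \<epsilon> l (cell V f (f u)) (cell V f (f v)) \<longrightarrow> u \<in> A \<or> v \<in> A \<or> u \<in> B \<and> v \<in> B))"
proof -
  let ?I = "f ` V"
  define s where "s = (\<lambda>i. real (card (cell V f i)))"
  define E where "E = {(i,j)\<in>?I \<times> ?I. robust \<phi> b \<epsilon> l (cell V f i) (cell V f j)}"
  have EI: "E \<subseteq> ?I \<times> ?I" by (auto simp: E_def)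
  have finI: "finite ?I" using V by simp
  have finE: "finite E" by (rule finite_subset[OF EI]) (use finI in simp)
  have symE: "sym E" by (auto simp: E_def sym_def intro: iffD1[OF robust_commute])
  have s0: "0 \<le> s i" for i by (simp add: s_def)
  from packing_or_covering[OF finE finI, where s = s and M = "\<lambda>e i. real (usage a b e i)" and \<theta> = \<theta>, OF s0]
  show ?thesis
  proof (elim disjE exE conjE)
    fix w assume 1: "\<forall>e\<in>E. 0 \<le> w e" "\<forall>i\<in>?I. (\<Sum>e\<in>E. real (usage a b e i) * w e) \<le> s i" "\<theta> \<le> (\<Sum>e\<in>E. w e)"
    obtain m U where mU: "tiled \<phi> a b l m U" "U \<subseteq> V" "(1 - \<epsilon>) * (\<Sum>e\<in>E. w e) - real (card ?I ^ 2) \<le> real m"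
    proof -
      have "robust \<phi> b \<epsilon> l (cell V f i) (cell V f j)" if "(i,j) \<in> E" for i j using that by (simp add: E_def)
      moreover have "0 \<le> w e" if "e \<in> E" for e using 1(1) that by blast
      moreover have "(\<Sum>e\<in>E. real (usage a b e i) * w e) \<le> card (cell V f i)" if "i \<in> ?I" for i
        using 1(2) that unfolding s_def by blast
      ultimately show ?thesis using fractional_tiling_realised[OF V ab(2) \<epsilon> EI] that by blast
    qed
    have "(1 - \<epsilon>) * \<theta> \<le> (1 - \<epsilon>) * (\<Sum>e\<in>E. w e)" using 1 \<epsilon> by (intro mult_left_mono) auto
    then have "(1 - \<epsilon>) * \<theta> - real (card ?I ^ 2) \<le> real m" using mU(3) by linarith
    then show ?thesis using mU(1,2) by blast
  next
    fix c assume 2: "\<forall>i\<in>?I. 0 \<le> c i" "\<forall>e\<in>E. 1 \<le> (\<Sum>i\<in>?I. real (usage a b e i) * c i)" "(\<Sum>i\<in>?I. s i * c i) < \<theta>"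
    have cov: "1 \<le> real a * c i + real b * c j" if "(i,j) \<in> E" for i j
    proof -
      have ij: "i \<in> ?I" "j \<in> ?I" using that EI by auto
      have "(\<Sum>k\<in>?I. real (usage a b (i,j) k) * c k)
          = (\<Sum>k\<in>?I. (if i = k then real a * c k else 0) + (if j = k then real b * c k else 0))"
        by (rule sum.cong) (auto simp: usage_def algebra_simps)
      also have "\<dots> = real a * c i + real b * c j" using ij finI by (simp add: sum.distrib)
      finally show ?thesis using 2(2) that by force
    qed
    have ab': "0 < real a" "0 < real b" using ab by auto
    have "\<exists>A B. A \<subseteq> ?I \<and> B \<subseteq> ?I \<and> (\<forall>(i,j)\<in>E. i \<in> A \<or> j \<in> A \<or> i \<in> B \<and> j \<in> B) \<and>
      sum s A / real a + sum s B / (real a + real b) \<le> (\<Sum>i\<in>?I. s i * c i)"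
      by (rule cover_rounding[OF ab' finI _ _ EI symE cov]) (use 2(1) s0 in blast)+
    then obtain A B where AB: "A \<subseteq> ?I" "B \<subseteq> ?I" "\<forall>(i,j)\<in>E. i \<in> A \<or> j \<in> A \<or> i \<in> B \<and> j \<in> B"
      "sum s A / real a + sum s B / (real a + real b) \<le> (\<Sum>i\<in>?I. s i * c i)" by (elim exE conjE)
    have card_pre: "real (card {v\<in>V. f v \<in> X}) = sum s X" if "X \<subseteq> ?I" for X
    proof -
      have "card {v\<in>V. f v \<in> X} = card (\<Union>i\<in>X. cell V f i)"
        by (rule arg_cong[where f = card]) (auto simp: cell_def)
      also have "\<dots> = (\<Sum>i\<in>X. card (cell V f i))"
        using that V finI by (intro card_UN_disjoint) (auto simp: cell_def intro: finite_subset)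
      finally show ?thesis by (simp add: s_def)
    qed
    show ?thesis
    proof (rule disjI2, rule exI[where x = "{v\<in>V. f v \<in> A}"], rule exI[where x = "{v\<in>V. f v \<in> B}"],
        intro conjI ballI impI)
      show "real (card {v\<in>V. f v \<in> A}) / real a + real (card {v\<in>V. f v \<in> B}) / real (a + b) < \<theta>"
        using AB(4) 2(3) unfolding card_pre[OF AB(1)] card_pre[OF AB(2)] by simp
      fix u v assume "u \<in> V" "v \<in> V" "robust \<phi> b \<epsilon> l (cell V f (f u)) (cell V f (f v))"
      then have "(f u, f v) \<in> E" by (auto simp: E_def)
      have "f u \<in> A \<or> f v \<in> A \<or> f u \<in> B \<and> f v \<in> B" using AB(3) \<open>(f u, f v) \<in> E\<close> by blast
      then show "u \<in> {v\<in>V. f v \<in> A} \<or> v \<in> {v\<in>V. f v \<in> A} \<or> u \<in> {v\<in>V. f v \<in> B} \<and> v \<in> {v\<in>V. f v \<in> B}"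
        using \<open>u \<in> V\<close> \<open>v \<in> V\<close> by auto
    qed auto
  qed
qed

section \<open>The lower bound\<close>

text \<open>
  The type of a vertex is the pair of its sets of \<open>A\<close>-colours and \<open>B\<close>-colours, so there are \<open>2^5 \<cdot> 2^5 = 1024\<close>
  types. Vertices of rare types are discarded. For two remaining types the pairs of vertices of these
  types outnumber the exceptional pairs \<open>X\<close>, so some pair is not exceptional and the types are
  compatible. Hence the \<open>B\<close>-sets of remaining types without \<open>A\<close>-colours form an intersecting family,
  and the colour weights \<open>z\<close> from \<open>intersecting_five\<close> make each remaining vertex pay at least 1.
\<close>

lemma cover_system_cost:
  fixes V :: "'v set" and A B :: "nat \<Rightarrow> 'v set" and a b D \<eta> :: real
  assumes V: "finite V" and L: "L \<subseteq> V" and \<eta>: "0 < \<eta>" and ab: "0 < a" "a \<le> b"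
    and D: "5*a+b \<le> D" "(7*a+3*b)/2 \<le> D" "(8*a+5*b)/3 \<le> D" "9*(a+b)/5 \<le> D"
    and AB: "\<And>l. A l \<subseteq> V" "\<And>l. B l \<subseteq> V"
    and X: "finite X" "real (card X) < (\<eta> * card V)\<^sup>2"
    and cov: "\<And>u v. u \<in> L \<Longrightarrow> v \<in> L \<Longrightarrow> (u,v) \<notin> X \<Longrightarrow> \<exists>l\<in>{1..5}. u \<in> A l \<or> v \<in> A l \<or> u \<in> B l \<and> v \<in> B l"
  shows "\<exists>l\<in>{1..5}. real (card L) - 1024 * (\<eta> * card V) \<le> D * (real (card (A l)) / a + real (card (B l)) / (a + b))"
proof (rule ccontr)
  assume neg: "\<not> ?thesis"
  define \<tau> where "\<tau> = (\<lambda>v. ({l\<in>{1..5::nat}. v \<in> A l}, {l\<in>{1..5::nat}. v \<in> B l}))"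
  define T where "T = (\<lambda>t. {v\<in>L. \<tau> v = t})"
  define R where "R = {v\<in>L. \<eta> * card V \<le> real (card (T (\<tau> v)))}"
  have finL: "finite L" using L V finite_subset by auto
  let ?Ty = "Pow {1..5::nat} \<times> Pow {1..5::nat}"
  have cTy: "card ?Ty = 1024" by (simp add: card_cartesian_product card_Pow)
  have "\<tau> v \<in> ?Ty" for v unfolding \<tau>_def by blast
  then have "L - R = (\<Union>t\<in>{t\<in>?Ty. real (card (T t)) < \<eta> * card V}. T t)"
    unfolding R_def T_def by (intro equalityI subsetI) (simp_all add: not_le)
  then have "card (L - R) \<le> (\<Sum>t\<in>{t\<in>?Ty. real (card (T t)) < \<eta> * card V}. card (T t))"
    using card_UN_le[of "{t\<in>?Ty. real (card (T t)) < \<eta> * card V}" T] by simp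
  then have "real (card (L - R)) \<le> (\<Sum>t\<in>{t\<in>?Ty. real (card (T t)) < \<eta> * card V}. real (card (T t)))"
    unfolding of_nat_sum[symmetric] of_nat_le_iff .
  also have "\<dots> \<le> (\<Sum>t\<in>{t\<in>?Ty. real (card (T t)) < \<eta> * card V}. \<eta> * card V)"
    by (intro sum_mono) auto
  also have "\<dots> \<le> (\<Sum>t\<in>?Ty. \<eta> * card V)" using \<eta> by (intro sum_mono2) auto
  also have "\<dots> = 1024 * (\<eta> * card V)" using cTy by simp
  finally have small: "real (card (L - R)) \<le> 1024 * (\<eta> * card V)" .
  have RL: "R \<subseteq> L" by (auto simp: R_def)
  have "card L = card R + card (L - R)" using card_Diff_subset[OF finite_subset[OF RL finL] RL] card_mono[OF finL RL] by simp
  then have cR: "real (card L) - 1024 * (\<eta> * card V) \<le> real (card R)" using small by linarith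
  have types: "\<exists>l\<in>{1..5}. u \<in> A l \<or> v \<in> A l \<or> u \<in> B l \<and> v \<in> B l" if "u \<in> R" "v \<in> R" for u v
  proof -
    have "(\<eta> * card V)\<^sup>2 \<le> real (card (T (\<tau> u))) * real (card (T (\<tau> v)))"
      unfolding power2_eq_square using that \<eta> by (intro mult_mono) (auto simp: R_def)
    also have "\<dots> = real (card (T (\<tau> u) \<times> T (\<tau> v)))" by (simp add: card_cartesian_product)
    finally have "card X < card (T (\<tau> u) \<times> T (\<tau> v))" using X(2) by linarith
    then have "\<not> T (\<tau> u) \<times> T (\<tau> v) \<subseteq> X" using card_mono[OF X(1)] by (meson not_le)
    then obtain u' v' where uv: "u' \<in> T (\<tau> u)" "v' \<in> T (\<tau> v)" "(u',v') \<notin> X" by auto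
    then have "u' \<in> L" "v' \<in> L" "\<tau> u' = \<tau> u" "\<tau> v' = \<tau> v" by (auto simp: T_def)
    then have "{l\<in>{1..5::nat}. u' \<in> A l} = {l\<in>{1..5}. u \<in> A l}" "{l\<in>{1..5::nat}. u' \<in> B l} = {l\<in>{1..5}. u \<in> B l}"
      "{l\<in>{1..5::nat}. v' \<in> A l} = {l\<in>{1..5}. v \<in> A l}" "{l\<in>{1..5::nat}. v' \<in> B l} = {l\<in>{1..5}. v \<in> B l}"
      by (simp_all only: \<tau>_def prod.inject)
    moreover obtain l where "l \<in> {1..5}" "u' \<in> A l \<or> v' \<in> A l \<or> u' \<in> B l \<and> v' \<in> B l"
      using cov[OF \<open>u' \<in> L\<close> \<open>v' \<in> L\<close> uv(3)] by blast
    ultimately have "u \<in> A l \<or> v \<in> A l \<or> u \<in> B l \<and> v \<in> B l" by blast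
    then show ?thesis using \<open>l \<in> {1..5}\<close> by blast
  qed
  define F where "F = {{l\<in>{1..5::nat}. v \<in> B l} |v. v \<in> R \<and> (\<forall>l\<in>{1..5}. v \<notin> A l)}"
  have "\<exists>z. (\<forall>i\<in>{1..5::nat}. a \<le> z i) \<and> (\<forall>S\<in>F. a + b \<le> sum z S) \<and> sum z {1..5} \<le> D"
  proof (rule intersecting_five[OF _ _ ab D])
    show "S \<subseteq> {1..5}" if "S \<in> F" for S using that by (auto simp: F_def)
    show "S \<inter> S' \<noteq> {}" if SS: "S \<in> F" "S' \<in> F" for S S'
    proof -
      obtain u v where uv: "S = {l\<in>{1..5::nat}. u \<in> B l}" "S' = {l\<in>{1..5::nat}. v \<in> B l}" "u \<in> R" "v \<in> R"
        "\<forall>l\<in>{1..5}. u \<notin> A l" "\<forall>l\<in>{1..5}. v \<notin> A l" using SS by (auto simp: F_def)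
      then show ?thesis using types[OF uv(3,4)] by auto
    qed
  qed
  then obtain z where z: "\<And>i. i \<in> {1..5} \<Longrightarrow> a \<le> z i" "\<And>S. S \<in> F \<Longrightarrow> a + b \<le> sum z S" "sum z {1..5} \<le> D" by blast
  define pay where "pay = (\<lambda>v l. (if v \<in> A l then 1 / a else 0) + (if v \<in> B l then 1 / (a + b) else 0))"
  have pay0: "0 \<le> pay v l" for v l using ab by (auto simp: pay_def)
  have z0: "0 \<le> z l" if "l \<in> {1..5}" for l using z(1)[OF that] ab by simp
  have one: "1 \<le> (\<Sum>l\<in>{1..5}. z l * pay v l)" if vR: "v \<in> R" for v
  proof (cases "\<exists>l\<in>{1..5}. v \<in> A l")
    case True
    then obtain l where l: "l \<in> {1..5}" "v \<in> A l" by blast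
    have "1 \<le> z l * (1 / a)" using z(1)[OF l(1)] ab by (simp add: field_simps)
    also have "\<dots> \<le> z l * pay v l" using z0[OF l(1)] ab l by (intro mult_left_mono) (auto simp: pay_def)
    also have "\<dots> \<le> (\<Sum>l\<in>{1..5}. z l * pay v l)"
      using l pay0 z0 by (intro member_le_sum) auto
    finally show ?thesis .
  next
    case False
    then have "{l\<in>{1..5::nat}. v \<in> B l} \<in> F" using vR by (auto simp: F_def)
    from z(2)[OF this] have "1 \<le> (\<Sum>l\<in>{l\<in>{1..5::nat}. v \<in> B l}. z l) * (1 / (a + b))" using ab by (simp add: field_simps)
    also have "\<dots> = (\<Sum>l\<in>{l\<in>{1..5::nat}. v \<in> B l}. z l * pay v l)"
      unfolding sum_distrib_right by (rule sum.cong) (use False in \<open>auto simp: pay_def\<close>)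
    also have "\<dots> \<le> (\<Sum>l\<in>{1..5}. z l * pay v l)"
      using pay0 z0 by (intro sum_mono2) auto
    finally show ?thesis .
  qed
  have cost: "(\<Sum>v\<in>V. pay v l) = real (card (A l)) / a + real (card (B l)) / (a + b)" for l
  proof -
    have "(\<Sum>v\<in>V. if v \<in> Y then c else 0) = real (card Y) * c" if "Y \<subseteq> V" for Y and c :: real
      using V that by (simp add: sum.If_cases Int_absorb1)
    then show ?thesis using AB by (simp add: pay_def sum.distrib)
  qed
  have RV: "R \<subseteq> V" using RL L by auto
  define M where "M = real (card L) - 1024 * (\<eta> * card V)"
  have lt: "D * (real (card (A l)) / a + real (card (B l)) / (a + b)) < M" if "l \<in> {1..5}" for l
    using neg that unfolding M_def by force
  have D0: "0 < D" using D(1) ab by linarith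
  have "real (card R) \<le> (\<Sum>v\<in>R. \<Sum>l\<in>{1..5}. z l * pay v l)"
    using sum_mono[of R "\<lambda>_. 1" "\<lambda>v. \<Sum>l\<in>{1..5}. z l * pay v l"] one by simp
  also have "\<dots> \<le> (\<Sum>v\<in>V. \<Sum>l\<in>{1..5}. z l * pay v l)"
    using RV V pay0 z0 by (intro sum_mono2 sum_nonneg) auto
  also have "\<dots> = (\<Sum>l\<in>{1..5}. z l * (\<Sum>v\<in>V. pay v l))"
    by (subst sum.swap) (simp add: sum_distrib_left)
  also have "\<dots> < (\<Sum>l\<in>{1..5}. z l * (M / D))"
  proof (rule sum_strict_mono)
    fix l :: nat assume l: "l \<in> {1..5}"
    have "(\<Sum>v\<in>V. pay v l) < M / D" using lt[OF l] D0 unfolding cost by (simp add: field_simps)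
    then show "z l * (\<Sum>v\<in>V. pay v l) < z l * (M / D)" using z(1)[OF l] ab by (intro mult_strict_left_mono) auto
  qed auto
  also have "\<dots> = sum z {1..5} * (M / D)" by (rule sum_distrib_right[symmetric])
  also have "\<dots> \<le> D * (M / D)"
  proof (rule mult_right_mono[OF z(3)])
    have "0 \<le> real (card (A 1)) / a + real (card (B 1)) / (a + b)" using ab by simp
    then have "0 \<le> D * (real (card (A 1)) / a + real (card (B 1)) / (a + b))" using D0 by simp
    then have "0 < M" using lt[of 1] by simp
    then show "0 \<le> M / D" using D0 by simp
  qed
  also have "\<dots> = M" using D0 by simp
  finally show False using cR by (simp add: M_def)
qed

lemma nonfickle_colour:
  fixes f :: "nat \<Rightarrow> nat"
  assumes \<phi>: "\<phi> \<in> edges (complete_graph n) \<rightarrow>\<^sub>E {1..5::nat}"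
    and uv: "u < n" "v < n" "(u,v) \<notin> fickle_pairs \<phi> 5 b \<epsilon> {..<n} f"
    and big: "5 * b + b * 5 ^ (5 * b) \<le> card (cell {..<n} f (f u))" "5 * b + b * 5 ^ (5 * b) \<le> card (cell {..<n} f (f v))"
  shows "\<exists>l\<in>{1..5}. robust \<phi> b \<epsilon> l (cell {..<n} f (f u)) (cell {..<n} f (f v))"
proof -
  have "\<phi> {x,y} \<in> {1..5}" if "x < n" "y < n" "x \<noteq> y" for x y
  proof (rule PiE_mem[OF \<phi>])
    show "{x,y} \<in> edges (complete_graph n)" using that by (auto simp: complete_graph_def)
  qed
  then have "\<exists>l\<in>{1..5}. mono_biclique \<phi> b l (cell {..<n} f (f u)) (cell {..<n} f (f v))"
    using big by (intro bipartite_pigeonhole) (auto simp: cell_def)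
  then show ?thesis using uv by (auto simp: fickle_pairs_def fickle_def)
qed

text \<open>
  The parameters: \<open>\<eta> = e/1024\<close> makes the discarded rare types amount to at most \<open>e n\<close> vertices, and the
  partition is chosen with fewer than \<open>(\<eta> n)\<^sup>2\<close> fickle pairs. Vertices in cells too small for
  \<open>bipartite_pigeonhole\<close> are ignored, there are at most \<open>K N\<close> of them. If no colour had the claimed
  tiling, all five would have covers of cost below \<open>\<theta>\<close>, contrary to \<open>cover_system_cost\<close>.
\<close>

lemma colouring_has_tiling:
  fixes a b :: nat and D e :: real
  assumes ab: "1 \<le> a" "a \<le> b" and e: "0 < e" "e \<le> 1"
    and D: "5*real a+real b \<le> D" "(7*real a+3*real b)/2 \<le> D" "(8*real a+5*real b)/3 \<le> D" "9*(real a+real b)/5 \<le> D"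
  shows "\<exists>C\<ge>0. \<forall>n>0. \<forall>\<phi>\<in>edges (complete_graph n) \<rightarrow>\<^sub>E {1..5::nat}. \<exists>l\<in>{1..5}. \<exists>m U.
    tiled \<phi> a b l m U \<and> U \<subseteq> {..<n} \<and> (1 - e) * (((1 - e) * real n - C) / D) - C \<le> real m"
proof -
  define \<eta> where "\<eta> = e / 1024"
  define N where "N = 5 * b + b * 5 ^ (5 * b)"
  have \<eta>: "0 < \<eta>" using e by (simp add: \<eta>_def)
  then have "0 < \<eta>\<^sup>2 / 2" by simp
  from robust_partition[OF e(1) this, where r = 5 and b = b] obtain K where
    K: "\<forall>\<phi>::nat set \<Rightarrow> nat. \<forall>V. finite V \<longrightarrow> (\<exists>f::nat \<Rightarrow> nat. card (f ` V) \<le> K \<and>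
      real (card (fickle_pairs \<phi> 5 b e V f)) \<le> \<eta>\<^sup>2 / 2 * (real (card V))\<^sup>2)" by (elim exE)
  define C where "C = real (K * N + K\<^sup>2)"
  have D0: "0 < D" using D(1) ab by linarith
  show ?thesis
  proof (intro exI[of _ C] conjI allI impI ballI)
    show "0 \<le> C" by (simp add: C_def)
    fix n :: nat and \<phi> assume n: "0 < n" and \<phi>: "\<phi> \<in> edges (complete_graph n) \<rightarrow>\<^sub>E {1..5::nat}"
    let ?V = "{..<n}"
    from K obtain f where f: "card (f ` ?V) \<le> K" "real (card (fickle_pairs \<phi> 5 b e ?V f)) \<le> \<eta>\<^sup>2 / 2 * (real (card ?V))\<^sup>2"
      by blast
    define \<theta> where "\<theta> = ((1 - e) * real n - C) / D"
    show "\<exists>l\<in>{1..5}. \<exists>m U. tiled \<phi> a b l m U \<and> U \<subseteq> ?V \<and> (1 - e) * (((1 - e) * real n - C) / D) - C \<le> real m"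
    proof (rule ccontr)
      assume neg: "\<not> ?thesis"
      define Q where "Q = (\<lambda>l A B. A \<subseteq> ?V \<and> B \<subseteq> ?V \<and> real (card A) / real a + real (card B) / real (a + b) < \<theta> \<and>
        (\<forall>u\<in>?V. \<forall>v\<in>?V. robust \<phi> b e l (cell ?V f (f u)) (cell ?V f (f v)) \<longrightarrow> u \<in> A \<or> v \<in> A \<or> u \<in> B \<and> v \<in> B))"
      have "\<exists>A B. Q l A B" if l: "l \<in> {1..5}" for l
      proof -
        have no: "\<not> (\<exists>m U. tiled \<phi> a b l m U \<and> U \<subseteq> ?V \<and> (1 - e) * \<theta> - real (card (f ` ?V) ^ 2) \<le> real m)"
        proof
          assume "\<exists>m U. tiled \<phi> a b l m U \<and> U \<subseteq> ?V \<and> (1 - e) * \<theta> - real (card (f ` ?V) ^ 2) \<le> real m"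
          then obtain m U where mU: "tiled \<phi> a b l m U" "U \<subseteq> ?V" "(1 - e) * \<theta> - real (card (f ` ?V) ^ 2) \<le> real m" by blast
          have "real (card (f ` ?V) ^ 2) \<le> real (K\<^sup>2)" using f(1) by (intro of_nat_mono power_mono) auto
          also have "\<dots> \<le> C" by (simp add: C_def)
          finally have "(1 - e) * (((1 - e) * real n - C) / D) - C \<le> real m" using mU(3) by (simp add: \<theta>_def)
          then show False using neg l mU by blast
        qed
        have "0 \<le> e" using e by simp
        from tiling_or_cover[OF finite_lessThan[of n] ab this e(2), where \<phi> = \<phi> and l = l and \<theta> = \<theta> and f = f] no show ?thesis unfolding Q_def by blast
      qed
      then obtain A B where Q: "\<And>l. l \<in> {1..5} \<Longrightarrow> Q l (A l) (B l)" by metis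
      have AB: "A l \<subseteq> ?V" "B l \<subseteq> ?V" "real (card (A l)) / real a + real (card (B l)) / real (a + b) < \<theta>"
        "\<And>u v. u \<in> ?V \<Longrightarrow> v \<in> ?V \<Longrightarrow> robust \<phi> b e l (cell ?V f (f u)) (cell ?V f (f v)) \<Longrightarrow>
           u \<in> A l \<or> v \<in> A l \<or> u \<in> B l \<and> v \<in> B l" if "l \<in> {1..5}" for l
        using Q[OF that] unfolding Q_def by blast+
      define L where "L = {v\<in>?V. N \<le> card (cell ?V f (f v))}"
      have "?V - L \<subseteq> (\<Union>i\<in>{i\<in>f ` ?V. card (cell ?V f i) < N}. cell ?V f i)"
        by (auto simp: L_def cell_def)
      then have "card (?V - L) \<le> card (\<Union>i\<in>{i\<in>f ` ?V. card (cell ?V f i) < N}. cell ?V f i)"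
        by (intro card_mono) (auto simp: cell_def)
      also have "\<dots> \<le> (\<Sum>i\<in>{i\<in>f ` ?V. card (cell ?V f i) < N}. card (cell ?V f i))"
        by (rule card_UN_le) auto
      also have "\<dots> \<le> (\<Sum>i\<in>{i\<in>f ` ?V. card (cell ?V f i) < N}. N)" by (intro sum_mono) auto
      also have "\<dots> \<le> (\<Sum>i\<in>f ` ?V. N)" by (intro sum_mono2) auto
      also have "\<dots> \<le> K * N" using f(1) by simp
      finally have "card (?V - L) \<le> K * N" .
      moreover have LV: "L \<subseteq> ?V" by (auto simp: L_def)
      then have "card (?V - L) = n - card L" "card L \<le> n"
        using card_Diff_subset[OF finite_subset[OF LV finite_lessThan] LV] card_mono[OF finite_lessThan LV] by simp_all
      ultimately have "n \<le> card L + K * N + K\<^sup>2" by linarith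
      then have "real n \<le> real (card L + K * N + K\<^sup>2)" by (rule of_nat_mono)
      then have cL: "real n - C \<le> real (card L)" by (simp add: C_def)
      \<comment> \<open>The covers are only given for the five colours; outside them the empty set serves.\<close>
      define A' where "A' = (\<lambda>l. if l \<in> {1..5} then A l else {})"
      define B' where "B' = (\<lambda>l. if l \<in> {1..5} then B l else {})"
      have AB': "A' l = A l" "B' l = B l" if "l \<in> {1..5}" for l using that by (simp_all add: A'_def B'_def)
      have sub: "A' l \<subseteq> ?V" "B' l \<subseteq> ?V" for l using AB(1,2)[of l] by (cases "l \<in> {1..5}"; simp add: A'_def B'_def)+
      have ab': "0 < real a" "real a \<le> real b" using ab by auto
      have "\<exists>l\<in>{1..5}. real (card L) - 1024 * (\<eta> * card ?V) \<le> D *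
         (real (card (A' l)) / real a + real (card (B' l)) / (real a + real b))"
      proof (rule cover_system_cost[OF finite_lessThan LV \<eta> ab' D sub])
        show "finite (fickle_pairs \<phi> 5 b e ?V f)"
          by (rule finite_subset[of _ "?V \<times> ?V"]) (auto simp: fickle_pairs_def)
        have "0 < (\<eta> * real n)\<^sup>2" using \<eta> n by simp
        then show "real (card (fickle_pairs \<phi> 5 b e ?V f)) < (\<eta> * real (card ?V))\<^sup>2"
          using f(2) by (simp add: power_mult_distrib)
        fix u v assume uv: "u \<in> L" "v \<in> L" "(u,v) \<notin> fickle_pairs \<phi> 5 b e ?V f"
        then have "\<exists>l\<in>{1..5}. robust \<phi> b e l (cell ?V f (f u)) (cell ?V f (f v))"
          using nonfickle_colour[OF \<phi>] by (simp add: L_def N_def)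
        then obtain l where l: "l \<in> {1..5}" "robust \<phi> b e l (cell ?V f (f u)) (cell ?V f (f v))" by blast
        have "u \<in> ?V" "v \<in> ?V" using uv by (auto simp: L_def)
        then have "u \<in> A l \<or> v \<in> A l \<or> u \<in> B l \<and> v \<in> B l" using l(2) by (rule AB(4)[OF l(1)])
        then show "\<exists>l\<in>{1..5}. u \<in> A' l \<or> v \<in> A' l \<or> u \<in> B' l \<and> v \<in> B' l"
          unfolding AB'[OF l(1), symmetric] using l(1) by blast
      qed
      then obtain l where l: "l \<in> {1..5}" and le: "real (card L) - 1024 * (\<eta> * card ?V) \<le> D *
         (real (card (A l)) / real a + real (card (B l)) / (real a + real b))" using AB' by auto
      have "real (card (A l)) / real a + real (card (B l)) / (real a + real b) < \<theta>" using AB(3)[OF l] by simp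
      then have "D * (real (card (A l)) / real a + real (card (B l)) / (real a + real b)) < D * \<theta>" using D0 by simp
      also have "\<dots> = (1 - e) * real n - C" using D0 by (simp add: \<theta>_def)
      finally show False using le cL by (simp add: \<eta>_def algebra_simps)
    qed
  qed
qed

lemma Rt_five_lower:
  fixes a b :: nat and D e :: real
  assumes ab: "1 \<le> a" "a \<le> b" and e: "0 < e"
    and D: "5*real a+real b \<le> D" "(7*real a+3*real b)/2 \<le> D" "(8*real a+5*real b)/3 \<le> D" "9*(real a+real b)/5 \<le> D"
  shows "\<exists>C. \<forall>n. (1 / D - e) * real n - C \<le> real (Rt 5 (complete_bipartite_graph a b) (complete_graph n))"
proof -
  define e' where "e' = min 1 (e / 2)"
  have e': "0 < e'" "e' \<le> 1" "2 * e' \<le> e" using e by (auto simp: e'_def)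
  have D1: "1 \<le> D" using D(1) ab by linarith
  from colouring_has_tiling[OF ab e'(1,2) D]
  obtain C where C0: "0 \<le> C" and C: "\<forall>n>0. \<forall>\<phi>\<in>edges (complete_graph n) \<rightarrow>\<^sub>E {1..5::nat}. \<exists>l\<in>{1..5}. \<exists>m U.
    tiled \<phi> a b l m U \<and> U \<subseteq> {..<n} \<and> (1 - e') * (((1 - e') * real n - C) / D) - C \<le> real m"
    by (elim exE conjE)
  show ?thesis
  proof (intro exI[of _ "2 * C"] allI)
    fix n
    show "(1 / D - e) * real n - 2 * C \<le> real (Rt 5 (complete_bipartite_graph a b) (complete_graph n))"
    proof (cases "n = 0")
      case True then show ?thesis using C0 by simp
    next
      case False
      obtain \<phi> where \<phi>: "\<phi> \<in> edges (complete_graph n) \<rightarrow>\<^sub>E {1..5::nat}"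
        "Rt 5 (complete_bipartite_graph a b) (complete_graph n) = tiling_number 5 (complete_bipartite_graph a b) (complete_graph n) \<phi>"
        by (rule Rt_attained[OF finite_complete_graph(2)[of n], where r = 5]) auto
      from C \<phi>(1) False obtain l m U where l: "l \<in> {1..5}" "tiled \<phi> a b l m U" "U \<subseteq> {..<n}"
        and m: "(1 - e') * (((1 - e') * real n - C) / D) - C \<le> real m" by blast
      obtain \<P> where \<P>: "\<P> \<in> mono_packings (complete_bipartite_graph a b) (complete_graph n) \<phi> l" "card \<P> = m"
        using tiled_packing[OF l(2) ab(1) _ l(3)] ab by auto
      have "m \<le> Rt 5 (complete_bipartite_graph a b) (complete_graph n)"
        using tiling_number_ge[OF finite_complete_graph \<P>(1) l(1)] \<P>(2) \<phi>(2) by simp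
      moreover have "(1 / D - e) * real n - 2 * C \<le> (1 - e') * (((1 - e') * real n - C) / D) - C"
      proof -
        have dv: "x / D \<le> x" if "0 \<le> x" for x :: real
          using mult_left_mono[OF D1 that] D1 by (simp add: divide_le_eq)
        have "(1 - e') * (((1 - e') * real n - C) / D) = (1 - e')\<^sup>2 * real n / D - (1 - e') * (C / D)"
          by (simp add: power2_eq_square diff_divide_distrib add_divide_distrib algebra_simps)
        moreover have "(1 - e') * (C / D) \<le> 1 * C"
          using e' C0 D1 dv[OF C0] by (intro mult_mono) auto
        moreover have "(1 - 2 * e') * (real n / D) \<le> (1 - e')\<^sup>2 * (real n / D)"
          using D1 by (intro mult_right_mono) (auto simp: power2_eq_square algebra_simps)
        moreover have "2 * e' * (real n / D) \<le> e * real n"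
          using e' D1 dv[of "real n"] by (intro mult_mono) auto
        ultimately show ?thesis by (simp add: algebra_simps)
      qed
      ultimately show ?thesis using m by linarith
    qed
  qed
qed

section \<open>Covers bound tilings: the upper bound\<close>

text \<open>
  If fewer than \<open>a\<close> vertices lie in \<open>A\<close>, then both sides have a vertex outside \<open>A\<close>, and the edges at these
  two vertices force all other vertices into \<open>A \<union> B\<close>.
\<close>

lemma bipartite_copy_weight:
  fixes P Q :: "'v set"
  assumes ab: "1 \<le> a" "a \<le> b" and P: "card P = a" and Q: "card Q = b" and PQ: "P \<inter> Q = {}"
    and e: "\<And>p q. p \<in> P \<Longrightarrow> q \<in> Q \<Longrightarrow> p \<in> A \<or> q \<in> A \<or> p \<in> B \<and> q \<in> B"
  shows "1 \<le> real (card ((P \<union> Q) \<inter> A)) / real a + real (card ((P \<union> Q) \<inter> B)) / real (a + b)"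
proof -
  have fin: "finite P" "finite Q" using P Q ab by (auto intro: card_ge_0_finite)
  let ?W = "P \<union> Q"
  have mono: "card X \<le> card (?W \<inter> A)" if "X \<subseteq> ?W" "X \<subseteq> A" for X
    using fin that by (intro card_mono) auto
  show ?thesis
  proof (cases "a \<le> card (?W \<inter> A)")
    case True
    then have "1 \<le> real (card (?W \<inter> A)) / real a" using ab by (simp add: field_simps)
    moreover have "0 \<le> real (card (?W \<inter> B)) / real (a + b)" by simp
    ultimately show ?thesis by linarith
  next
    case False
    then have "\<not> P \<subseteq> A" "\<not> Q \<subseteq> A" using mono[of P] mono[of Q] P Q ab by auto
    then obtain p q where "p \<in> P" "p \<notin> A" "q \<in> Q" "q \<notin> A" by auto
    then have "?W \<subseteq> (?W \<inter> A) \<union> (?W \<inter> B)" using e by blast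
    then have "card ?W \<le> card ((?W \<inter> A) \<union> (?W \<inter> B))" using fin by (intro card_mono) auto
    also have "\<dots> \<le> card (?W \<inter> A) + card (?W \<inter> B)" by (rule card_Un_le)
    finally have "a + b \<le> card (?W \<inter> A) + card (?W \<inter> B)" using card_Un_disjoint[OF fin PQ] P Q by simp
    then have "real (a + b) \<le> real (card (?W \<inter> A)) + real (card (?W \<inter> B))" by linarith
    then have "1 \<le> real (card (?W \<inter> A)) / real (a + b) + real (card (?W \<inter> B)) / real (a + b)"
      unfolding add_divide_distrib[symmetric] using ab by (subst le_divide_eq) simp
    moreover have "real (card (?W \<inter> A)) / real (a + b) \<le> real (card (?W \<inter> A)) / real a"
      using ab by (intro divide_left_mono) auto
    ultimately show ?thesis by linarith
  qed
qed

lemma bipartite_copy_parts: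
  assumes "graph_iso (complete_bipartite_graph a b) F"
  obtains P Q where "verts F = P \<union> Q" "P \<inter> Q = {}" "card P = a" "card Q = b"
    "\<And>p q. p \<in> P \<Longrightarrow> q \<in> Q \<Longrightarrow> {p,q} \<in> edges F"
proof -
  obtain f where f: "bij_betw f ({..<a} <+> {..<b}) (verts F)"
    and e: "edges F = (\<lambda>e. f ` e) ` {{Inl i, Inr j} |i j. i < a \<and> j < b}"
    using assms by (auto simp: graph_iso_def complete_bipartite_graph_def)
  have inj: "inj_on f ({..<a} <+> {..<b})" and im: "f ` ({..<a} <+> {..<b}) = verts F"
    using f by (auto simp: bij_betw_def)
  show ?thesis
  proof (rule that[of "f ` Inl ` {..<a}" "f ` Inr ` {..<b}"])
    show "verts F = f ` Inl ` {..<a} \<union> f ` Inr ` {..<b}"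
      unfolding im[symmetric] by (simp add: Plus_def image_Un)
    show "f ` Inl ` {..<a} \<inter> f ` Inr ` {..<b} = {}"
      using inj by (auto simp: inj_on_def)
    have "inj_on f (Inl ` {..<a})" "inj_on f (Inr ` {..<b})"
      using inj by (auto intro: inj_on_subset)
    then show "card (f ` Inl ` {..<a}) = a" "card (f ` Inr ` {..<b}) = b" by (simp_all add: card_image)
    fix p q assume "p \<in> f ` Inl ` {..<a}" "q \<in> f ` Inr ` {..<b}"
    then obtain i j where "p = f (Inl i)" "q = f (Inr j)" "i < a" "j < b" by auto
    then show "{p,q} \<in> edges F" unfolding e by (intro image_eqI[of _ _ "{Inl i, Inr j}"]) auto
  qed
qed

lemma packing_card_le_weight:
  assumes ab: "1 \<le> a" "a \<le> b" and fin: "finite V" and A: "A \<subseteq> V" and B: "B \<subseteq> V"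
    and disj: "pairwise (\<lambda>F F'. verts F \<inter> verts F' = {}) \<P>" and finP: "finite \<P>"
    and iso: "\<And>F. F \<in> \<P> \<Longrightarrow> graph_iso (complete_bipartite_graph a b) F"
    and e: "\<And>F x y. F \<in> \<P> \<Longrightarrow> {x,y} \<in> edges F \<Longrightarrow> x \<in> A \<or> y \<in> A \<or> x \<in> B \<and> y \<in> B"
  shows "real (card \<P>) \<le> real (card A) / real a + real (card B) / real (a + b)"
proof -
  have one: "1 \<le> real (card (verts F \<inter> A)) / real a + real (card (verts F \<inter> B)) / real (a + b)" if F: "F \<in> \<P>" for F
  proof -
    obtain P Q where PQ: "verts F = P \<union> Q" "P \<inter> Q = {}" "card P = a" "card Q = b"
      "\<And>p q. p \<in> P \<Longrightarrow> q \<in> Q \<Longrightarrow> {p,q} \<in> edges F" by (rule bipartite_copy_parts[OF iso[OF F]]) (rule that)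
    show ?thesis unfolding PQ(1)
      by (rule bipartite_copy_weight[OF ab PQ(3,4,2)]) (rule e[OF F PQ(5)])
  qed
  have tot: "(\<Sum>F\<in>\<P>. card (verts F \<inter> X)) \<le> card X" if "finite X" for X
  proof -
    have "(\<Sum>F\<in>\<P>. card (verts F \<inter> X)) = card (\<Union>F\<in>\<P>. verts F \<inter> X)"
    proof (rule card_UN_disjoint[symmetric, OF finP])
      show "\<forall>F\<in>\<P>. finite (verts F \<inter> X)" using that by simp
      show "\<forall>F\<in>\<P>. \<forall>F'\<in>\<P>. F \<noteq> F' \<longrightarrow> (verts F \<inter> X) \<inter> (verts F' \<inter> X) = {}"
        using disj unfolding pairwise_def by blast
    qed
    also have "\<dots> \<le> card X" using that by (intro card_mono) auto
    finally show ?thesis .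
  qed
  have finA: "finite A" "finite B" using A B fin finite_subset by auto
  have "real (card \<P>) \<le> (\<Sum>F\<in>\<P>. real (card (verts F \<inter> A)) / real a + real (card (verts F \<inter> B)) / real (a + b))"
    using sum_mono[of \<P> "\<lambda>_. 1", OF one] by simp
  also have "\<dots> = real (\<Sum>F\<in>\<P>. card (verts F \<inter> A)) / real a + real (\<Sum>F\<in>\<P>. card (verts F \<inter> B)) / real (a + b)"
    by (simp add: sum.distrib sum_divide_distrib)
  also have "\<dots> \<le> real (card A) / real a + real (card B) / real (a + b)"
    using tot[OF finA(1)] tot[OF finA(2)] ab by (intro add_mono divide_right_mono) (auto simp only: of_nat_le_iff)
  finally show ?thesis .
qed

text \<open>
  Colour every edge with a colour in which it is covered.
\<close>

lemma Rt_le_cover_cost: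
  fixes A B :: "nat \<Rightarrow> nat set"
  assumes ab: "1 \<le> a" "a \<le> b" and r: "1 \<le> r"
    and AB: "\<And>l. A l \<subseteq> {..<n}" "\<And>l. B l \<subseteq> {..<n}"
    and cov: "\<And>u v. u < n \<Longrightarrow> v < n \<Longrightarrow> u \<noteq> v \<Longrightarrow> \<exists>l\<in>{1..r}. u \<in> A l \<or> v \<in> A l \<or> u \<in> B l \<and> v \<in> B l"
    and cost: "\<And>l. l \<in> {1..r} \<Longrightarrow> real (card (A l)) / real a + real (card (B l)) / real (a + b) \<le> t"
  shows "real (Rt r (complete_bipartite_graph a b) (complete_graph n)) \<le> t"
proof -
  let ?G = "complete_graph n" and ?H = "complete_bipartite_graph a b"
  have "\<exists>l. l \<in> {1..r} \<and> (e \<inter> A l \<noteq> {} \<or> e \<subseteq> B l)" if e: "e \<in> edges ?G" for e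
  proof -
    obtain u v where "e = {u,v}" "u \<noteq> v" "u < n" "v < n"
      using e by (auto simp: complete_graph_def card_2_iff)
    then show ?thesis using cov[of u v] by auto
  qed
  then obtain c where c: "\<And>e. e \<in> edges ?G \<Longrightarrow> c e \<in> {1..r} \<and> (e \<inter> A (c e) \<noteq> {} \<or> e \<subseteq> B (c e))" by metis
  define \<phi> where "\<phi> = restrict c (edges ?G)"
  have \<phi>: "\<phi> \<in> edges ?G \<rightarrow>\<^sub>E {1..r}" using c by (auto simp: \<phi>_def)
  have bound: "card \<P> \<le> nat \<lfloor>t\<rfloor>" if l: "l \<in> {1..r}" and P: "\<P> \<in> mono_packings ?H ?G \<phi> l" for l \<P>
  proof -
    have "real (card \<P>) \<le> real (card (A l)) / real a + real (card (B l)) / real (a + b)"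
    proof (rule packing_card_le_weight[OF ab finite_lessThan AB])
      show "pairwise (\<lambda>F F'. verts F \<inter> verts F' = {}) \<P>" using P by (simp add: mono_packings_def)
      have sub: "\<P> \<subseteq> mono_copies ?H ?G \<phi> l" using P by (simp add: mono_packings_def)
      then show "finite \<P>" using finite_mono_copies[OF finite_complete_graph] by (rule finite_subset)
      show "graph_iso ?H F" if "F \<in> \<P>" for F using sub that by (auto simp: mono_copies_def)
      fix F x y assume F: "F \<in> \<P>" "{x,y} \<in> edges F"
      then have "{x,y} \<in> edges ?G" "\<phi> {x,y} = l" using sub by (auto simp: mono_copies_def subgraph_def)
      then show "x \<in> A l \<or> y \<in> A l \<or> x \<in> B l \<and> y \<in> B l" using c[of "{x,y}"] by (auto simp: \<phi>_def)
    qed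
    also have "\<dots> \<le> t" by (rule cost[OF l])
    finally show ?thesis by linarith
  qed
  have "Rt r ?H ?G \<le> tiling_number r ?H ?G \<phi>" by (rule Rt_le[OF finite_complete_graph(2) \<phi>])
  also have "\<dots> \<le> nat \<lfloor>t\<rfloor>" by (rule tiling_number_le[OF finite_complete_graph r bound])
  finally have "Rt r ?H ?G \<le> nat \<lfloor>t\<rfloor>" .
  moreover have "0 \<le> t" using cost[of 1] r by (smt (verit) atLeastAtMost_iff divide_nonneg_nonneg of_nat_0_le_iff order_refl)
  ultimately show ?thesis by linarith
qed

lemma labelling_with_sizes:
  fixes s :: "nat \<Rightarrow> nat"
  assumes "n \<le> (\<Sum>j<k. s j)"
  shows "\<exists>g. (\<forall>v<n. g v < k) \<and> (\<forall>j. card {v. v < n \<and> g v = j} \<le> s j)"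
  using assms
proof (induction k arbitrary: n)
  case 0
  then show ?case by auto
next
  case (Suc k)
  define n' where "n' = n - s k"
  have "n' \<le> (\<Sum>j<k. s j)" using Suc.prems by (simp add: n'_def)
  from Suc.IH[OF this] obtain g where g: "\<And>v. v < n' \<Longrightarrow> g v < k" "\<And>j. card {v. v < n' \<and> g v = j} \<le> s j" by blast
  define h where "h = (\<lambda>v. if v < n' then g v else k)"
  have "card {v. v < n \<and> h v = j} \<le> s j" for j
  proof (cases "j = k")
    case True
    have "n' \<le> v" if "h v = j" for v
      using that True g(1)[of v] by (cases "v < n'") (auto simp: h_def)
    then have "{v. v < n \<and> h v = j} \<subseteq> {n'..<n}" by auto
    then have "card {v. v < n \<and> h v = j} \<le> card {n'..<n}" by (intro card_mono) auto
    then show ?thesis using True by (simp add: n'_def)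
  next
    case False
    have "{v. v < n \<and> h v = j} \<subseteq> {v. v < n' \<and> g v = j}" using False by (auto simp: h_def split: if_splits)
    then have "card {v. v < n \<and> h v = j} \<le> card {v. v < n' \<and> g v = j}" by (intro card_mono) auto
    then show ?thesis using g(2)[of j] by linarith
  qed
  moreover have "h v < Suc k" for v using g(1)[of v] by (auto simp: h_def)
  ultimately show ?case by blast
qed

text \<open>
  Splits the vertices into classes whose sizes are proportional to the weights \<open>\<mu>\<close>, up to rounding. A
  triple \<open>(X,Y,\<mu>)\<close> describes the vertices that lie in \<open>A\<^sub>l\<close> for \<open>l \<in> X\<close> and in \<open>B\<^sub>l\<close> for \<open>l \<in> Y\<close>.
\<close>

lemma Rt_le_weighted_types:
  fixes ts :: "(nat set \<times> nat set \<times> real) list" and T :: real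
  assumes ab: "1 \<le> a" "a \<le> b" and r: "1 \<le> r"
    and w: "\<And>X Y \<mu>. (X,Y,\<mu>) \<in> set ts \<Longrightarrow> 0 \<le> \<mu>" "(\<Sum>(X,Y,\<mu>)\<leftarrow>ts. \<mu>) = 1"
    and compat: "\<And>X Y \<mu> X' Y' \<mu>'. (X,Y,\<mu>) \<in> set ts \<Longrightarrow> (X',Y',\<mu>') \<in> set ts \<Longrightarrow> \<exists>l\<in>{1..r}. l \<in> X \<or> l \<in> X' \<or> l \<in> Y \<and> l \<in> Y'"
    and cost: "\<And>l. l \<in> {1..r} \<Longrightarrow> (\<Sum>(X,Y,\<mu>)\<leftarrow>ts. \<mu> * ((if l \<in> X then 1 / real a else 0) + (if l \<in> Y then 1 / real (a + b) else 0))) \<le> T"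
  shows "real (Rt r (complete_bipartite_graph a b) (complete_graph n)) \<le> T * real n + 2 * real (length ts)"
proof -
  let ?k = "length ts"
  define X where "X = (\<lambda>j. fst (ts ! j))"
  define Y where "Y = (\<lambda>j. fst (snd (ts ! j)))"
  define \<mu> where "\<mu> = (\<lambda>j. snd (snd (ts ! j)))"
  have ts: "(X j, Y j, \<mu> j) \<in> set ts" if "j < ?k" for j using that by (simp add: X_def Y_def \<mu>_def)
  have sl: "(\<Sum>(X,Y,\<mu>)\<leftarrow>ts. h X Y \<mu>) = (\<Sum>j<?k. h (X j) (Y j) (\<mu> j))" for h :: "nat set \<Rightarrow> nat set \<Rightarrow> real \<Rightarrow> real"
    by (simp add: sum_list_sum_nth X_def Y_def \<mu>_def case_prod_unfold atLeast0LessThan)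
  define s where "s = (\<lambda>j. nat \<lceil>\<mu> j * real n\<rceil>)"
  have s: "\<mu> j * real n \<le> real (s j)" "real (s j) \<le> \<mu> j * real n + 1" if "j < ?k" for j
  proof -
    have "0 \<le> \<mu> j * real n" using w(1)[OF ts[OF that]] by simp
    then show "\<mu> j * real n \<le> real (s j)" "real (s j) \<le> \<mu> j * real n + 1" unfolding s_def by linarith+
  qed
  have "real n = (\<Sum>j<?k. \<mu> j * real n)" using w(2) by (simp add: sl sum_distrib_right[symmetric])
  also have "\<dots> \<le> real (\<Sum>j<?k. s j)" unfolding of_nat_sum using s by (intro sum_mono) auto
  finally have "n \<le> (\<Sum>j<?k. s j)" by (simp only: of_nat_le_iff)
  from labelling_with_sizes[OF this] obtain g where g: "\<And>v. v < n \<Longrightarrow> g v < ?k" "\<And>j. card {v. v < n \<and> g v = j} \<le> s j" by blast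
  have size: "real (card {v. v < n \<and> l \<in> Z (g v)}) \<le> (\<Sum>j<?k. if l \<in> Z j then \<mu> j * real n + 1 else 0)" for l and Z :: "nat \<Rightarrow> nat set"
  proof -
    have "{v. v < n \<and> l \<in> Z (g v)} = (\<Union>j\<in>{j. j < ?k \<and> l \<in> Z j}. {v. v < n \<and> g v = j})" using g(1) by auto
    then have "card {v. v < n \<and> l \<in> Z (g v)} \<le> (\<Sum>j\<in>{j. j < ?k \<and> l \<in> Z j}. card {v. v < n \<and> g v = j})"
      using card_UN_le[of "{j. j < ?k \<and> l \<in> Z j}" "\<lambda>j. {v. v < n \<and> g v = j}"] by simp
    then have "real (card {v. v < n \<and> l \<in> Z (g v)}) \<le> real (\<Sum>j\<in>{j. j < ?k \<and> l \<in> Z j}. card {v. v < n \<and> g v = j})"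
      by (rule of_nat_mono)
    also have "\<dots> \<le> (\<Sum>j\<in>{j. j < ?k \<and> l \<in> Z j}. \<mu> j * real n + 1)"
      unfolding of_nat_sum
    proof (rule sum_mono)
      fix j assume j: "j \<in> {j. j < ?k \<and> l \<in> Z j}"
      have "real (card {v. v < n \<and> g v = j}) \<le> real (s j)" using g(2) by (rule of_nat_mono)
      then show "real (card {v. v < n \<and> g v = j}) \<le> \<mu> j * real n + 1" using s(2)[of j] j by auto
    qed
    also have "\<dots> = (\<Sum>j\<in>{..<?k} \<inter> {j. l \<in> Z j}. \<mu> j * real n + 1)" by (rule sum.cong) auto
    also have "\<dots> = (\<Sum>j<?k. if l \<in> Z j then \<mu> j * real n + 1 else 0)"
      using sum.inter_restrict[of "{..<?k}" "\<lambda>j. \<mu> j * real n + 1" "{j. l \<in> Z j}"] by simp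
    finally show ?thesis .
  qed
  show ?thesis
  proof (rule Rt_le_cover_cost[OF ab r, where A = "\<lambda>l. {v. v < n \<and> l \<in> X (g v)}" and B = "\<lambda>l. {v. v < n \<and> l \<in> Y (g v)}"])
    fix u v assume uv: "u < n" "v < n" "u \<noteq> v"
    show "\<exists>l\<in>{1..r}. u \<in> {v. v < n \<and> l \<in> X (g v)} \<or> v \<in> {v. v < n \<and> l \<in> X (g v)} \<or>
      u \<in> {v. v < n \<and> l \<in> Y (g v)} \<and> v \<in> {v. v < n \<and> l \<in> Y (g v)}"
      using compat[OF ts[OF g(1)[OF uv(1)]] ts[OF g(1)[OF uv(2)]]] uv by blast
  next
    fix l assume l: "l \<in> {1..r}"
    define x where "x = (\<lambda>j. if l \<in> X j then 1 / real a else 0)"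
    define y where "y = (\<lambda>j. if l \<in> Y j then 1 / real (a + b) else 0)"
    have inv: "1 / real a \<le> 1" "1 / real (a + b) \<le> 1" using ab by auto
    have "real (card {v. v < n \<and> l \<in> X (g v)}) / real a \<le> (\<Sum>j<?k. if l \<in> X j then \<mu> j * real n + 1 else 0) / real a"
      using size[of l X] by (rule divide_right_mono) simp
    also have "\<dots> = (\<Sum>j<?k. (\<mu> j * real n + 1) * x j)"
      unfolding sum_divide_distrib by (rule sum.cong) (auto simp: x_def)
    finally have cA: "real (card {v. v < n \<and> l \<in> X (g v)}) / real a \<le> (\<Sum>j<?k. (\<mu> j * real n + 1) * x j)" .
    have "real (card {v. v < n \<and> l \<in> Y (g v)}) / real (a + b) \<le> (\<Sum>j<?k. if l \<in> Y j then \<mu> j * real n + 1 else 0) / real (a + b)"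
      using size[of l Y] by (rule divide_right_mono) simp
    also have "\<dots> = (\<Sum>j<?k. (\<mu> j * real n + 1) * y j)"
      unfolding sum_divide_distrib by (rule sum.cong) (auto simp: y_def)
    finally have cB: "real (card {v. v < n \<and> l \<in> Y (g v)}) / real (a + b) \<le> (\<Sum>j<?k. (\<mu> j * real n + 1) * y j)" .
    have "(\<Sum>j<?k. (\<mu> j * real n + 1) * x j) + (\<Sum>j<?k. (\<mu> j * real n + 1) * y j)
        = (\<Sum>j<?k. \<mu> j * (x j + y j) * real n + (x j + y j))"
      unfolding sum.distrib[symmetric] by (rule sum.cong) (simp_all add: algebra_simps)
    also have "\<dots> = (\<Sum>j<?k. \<mu> j * (x j + y j)) * real n + (\<Sum>j<?k. x j + y j)"
      unfolding sum.distrib[of "\<lambda>j. \<mu> j * (x j + y j) * real n"] sum_distrib_right ..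
    also have "\<dots> \<le> T * real n + (\<Sum>j<?k. 2)"
    proof (rule add_mono)
      show "(\<Sum>j<?k. \<mu> j * (x j + y j)) * real n \<le> T * real n"
        using cost[OF l] unfolding sl x_def y_def by (rule mult_right_mono) simp
      show "(\<Sum>j<?k. x j + y j) \<le> (\<Sum>j<?k. 2)"
      proof (rule sum_mono)
        fix j
        have "x j \<le> 1" "y j \<le> 1" using inv by (auto simp: x_def y_def)
        then show "x j + y j \<le> 2" by simp
      qed
    qed
    finally show "real (card {v. v < n \<and> l \<in> X (g v)}) / real a + real (card {v. v < n \<and> l \<in> Y (g v)}) / real (a + b)
       \<le> T * real n + 2 * real ?k" using cA cB by simp
  qed auto
qed

lemma five_colours: "{1..5::nat} = {1,2,3,4,5}"
  by (rule five_enum) auto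

text \<open>
  A colour used only through \<open>A\<close> gets \<open>p = a T\<close> of the vertices, where \<open>T\<close> is the claimed density. The other
  weights solve the linear system which says that every colour in the intersecting family has
  \<open>B\<close>-weight \<open>(a+b) T\<close>.
\<close>

lemma Rt_five_upper:
  fixes a b n :: nat
  assumes ab: "1 \<le> a" "a \<le> b"
  defines "R \<equiv> real (Rt 5 (complete_bipartite_graph a b) (complete_graph n))"
  shows "R \<le> 1 / (5 * real a + real b) * real n + 10"
    and "R \<le> 2 / (7 * real a + 3 * real b) * real n + 10"
    and "R \<le> 3 / (8 * real a + 5 * real b) * real n + 10"
    and "R \<le> 5 / (9 * (real a + real b)) * real n + 10"
proof -
  have pos: "0 < real a" "0 < real b" "0 < real a + real b" using ab by auto
  define s where "s = real a + real b"
  have s: "0 < s" "real (a + b) = s" using pos by (auto simp: s_def)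
  show "R \<le> 1 / (5 * real a + real b) * real n + 10"
  proof -
    define T where "T = 1 / (5 * real a + real b)"
    have d: "(5 * real a + real b) \<noteq> 0" using pos by linarith
    have "0 < T" using pos by (simp add: T_def)
    moreover have "T * (5 * real a + real b) = 1" by (rule iffD1[OF nonzero_eq_divide_eq[OF d] T_def])
    ultimately have T: "0 < T" "4 * (real a * T) + s * T = 1" by (simp_all add: s_def field_simps)
    define p q where "p = real a * T" and "q = s * T"
    have pq: "0 \<le> p" "0 \<le> q" "4 * p + q = 1"
      using T pos s(1) by (simp_all add: p_def q_def)
    have "p / real a = T" "q / s = T" using pos s(1) by (simp_all add: p_def q_def)
    note cost = this[unfolded s_def]
    let ?ts = "[({2},{},p), ({3},{},p), ({4},{},p), ({5},{},p), ({},{1},q)] :: (nat set \<times> nat set \<times> real) list"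
    have "R \<le> T * real n + 2 * real (length ?ts)" unfolding R_def
    proof (rule Rt_le_weighted_types[OF ab])
      show "(\<Sum>(X,Y,\<mu>)\<leftarrow>?ts. \<mu>) = 1" using pq by simp
      show "0 \<le> \<mu>" if "(X,Y,\<mu>) \<in> set ?ts" for X Y \<mu> using that pq(1,2) by auto
      show "\<exists>l\<in>{1..5}. l \<in> X \<or> l \<in> X' \<or> l \<in> Y \<and> l \<in> Y'"
        if "(X,Y,\<mu>) \<in> set ?ts" "(X',Y',\<mu>') \<in> set ?ts" for X Y \<mu> X' Y' \<mu>'
        using that unfolding five_colours by auto
      show "(\<Sum>(X,Y,\<mu>)\<leftarrow>?ts. \<mu> * ((if l \<in> X then 1 / real a else 0) + (if l \<in> Y then 1 / real (a + b) else 0))) \<le> T"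
        if "l \<in> {1..5}" for l
        using that unfolding five_colours by (auto simp: cost)
    qed simp
    then show ?thesis by (simp add: T_def)
  qed
  show "R \<le> 2 / (7 * real a + 3 * real b) * real n + 10"
  proof -
    define T where "T = 2 / (7 * real a + 3 * real b)"
    have d: "(7 * real a + 3 * real b) \<noteq> 0" using pos by linarith
    have "0 < T" using pos by (simp add: T_def)
    moreover have "T * (7 * real a + 3 * real b) = 2" by (rule iffD1[OF nonzero_eq_divide_eq[OF d] T_def])
    ultimately have T: "0 < T" "2 * (real a * T) + 3 * (s * T / 2) = 1" by (simp_all add: s_def field_simps)
    define p q where "p = real a * T" and "q = s * T / 2"
    have pq: "0 \<le> p" "0 \<le> q" "2 * p + 3 * q = 1"
      using T pos s(1) by (simp_all add: p_def q_def)
    have "p / real a = T" "q / s = T / 2" using pos s(1) by (simp_all add: p_def q_def)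
    note cost = this[unfolded s_def]
    let ?ts = "[({4},{},p), ({5},{},p), ({},{1,2},q), ({},{1,3},q), ({},{2,3},q)] :: (nat set \<times> nat set \<times> real) list"
    have "R \<le> T * real n + 2 * real (length ?ts)" unfolding R_def
    proof (rule Rt_le_weighted_types[OF ab])
      show "(\<Sum>(X,Y,\<mu>)\<leftarrow>?ts. \<mu>) = 1" using pq by simp
      show "0 \<le> \<mu>" if "(X,Y,\<mu>) \<in> set ?ts" for X Y \<mu> using that pq(1,2) by auto
      show "\<exists>l\<in>{1..5}. l \<in> X \<or> l \<in> X' \<or> l \<in> Y \<and> l \<in> Y'"
        if "(X,Y,\<mu>) \<in> set ?ts" "(X',Y',\<mu>') \<in> set ?ts" for X Y \<mu> X' Y' \<mu>'
        using that unfolding five_colours by auto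
      show "(\<Sum>(X,Y,\<mu>)\<leftarrow>?ts. \<mu> * ((if l \<in> X then 1 / real a else 0) + (if l \<in> Y then 1 / real (a + b) else 0))) \<le> T"
        if "l \<in> {1..5}" for l
        using that unfolding five_colours by (auto simp: cost)
    qed simp
    then show ?thesis by (simp add: T_def)
  qed
  show "R \<le> 3 / (8 * real a + 5 * real b) * real n + 10"
  proof -
    define T where "T = 3 / (8 * real a + 5 * real b)"
    have d: "(8 * real a + 5 * real b) \<noteq> 0" using pos by linarith
    have "0 < T" using pos by (simp add: T_def)
    moreover have "T * (8 * real a + 5 * real b) = 3" by (rule iffD1[OF nonzero_eq_divide_eq[OF d] T_def])
    ultimately have T: "0 < T" "real a * T + 5 * (s * T / 3) = 1" by (simp_all add: s_def field_simps)
    define p q where "p = real a * T" and "q = s * T / 3"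
    have pq: "0 \<le> p" "0 \<le> q" "p + 5 * q = 1"
      using T pos s(1) by (simp_all add: p_def q_def)
    have "p / real a = T" "q / s = T / 3" "2 * q / s = 2 * T / 3" using pos s(1) by (simp_all add: p_def q_def)
    note cost = this[unfolded s_def]
    let ?ts = "[({5},{},p), ({},{1,2},q), ({},{1,3},q), ({},{1,4},q), ({},{2,3,4},2 * q)] :: (nat set \<times> nat set \<times> real) list"
    have "R \<le> T * real n + 2 * real (length ?ts)" unfolding R_def
    proof (rule Rt_le_weighted_types[OF ab])
      show "(\<Sum>(X,Y,\<mu>)\<leftarrow>?ts. \<mu>) = 1" using pq by simp
      show "0 \<le> \<mu>" if "(X,Y,\<mu>) \<in> set ?ts" for X Y \<mu> using that pq(1,2) by auto
      show "\<exists>l\<in>{1..5}. l \<in> X \<or> l \<in> X' \<or> l \<in> Y \<and> l \<in> Y'"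
        if "(X,Y,\<mu>) \<in> set ?ts" "(X',Y',\<mu>') \<in> set ?ts" for X Y \<mu> X' Y' \<mu>'
        using that unfolding five_colours by auto
      show "(\<Sum>(X,Y,\<mu>)\<leftarrow>?ts. \<mu> * ((if l \<in> X then 1 / real a else 0) + (if l \<in> Y then 1 / real (a + b) else 0))) \<le> T"
        if "l \<in> {1..5}" for l
        using that unfolding five_colours by (auto simp: cost)
    qed simp
    then show ?thesis by (simp add: T_def)
  qed
  show "R \<le> 5 / (9 * (real a + real b)) * real n + 10"
  proof -
    define T where "T = 5 / (9 * (real a + real b))"
    define q where "q = (1 / 9 :: real)"
    have pq: "0 \<le> q" "9 * q = 1" by (simp_all add: q_def)
    have "q / s = T / 5" "2 * q / s = 2 * T / 5" "3 * q / s = 3 * T / 5" using s(1) by (simp_all add: q_def T_def flip: s_def)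
    note cost = this[unfolded s_def]
    \<comment> \<open>The weights \<open>1/9, 1/9, 3/9, 2/9, 2/9\<close> give each of the five colours total weight \<open>5/9\<close>.\<close>
    let ?ts = "[({},{1,2},q), ({},{1,3},q), ({},{1,4,5},3 * q), ({},{2,3,4},2 * q), ({},{2,3,5},2 * q)] :: (nat set \<times> nat set \<times> real) list"
    have "R \<le> T * real n + 2 * real (length ?ts)" unfolding R_def
    proof (rule Rt_le_weighted_types[OF ab])
      show "(\<Sum>(X,Y,\<mu>)\<leftarrow>?ts. \<mu>) = 1" using pq by simp
      show "0 \<le> \<mu>" if "(X,Y,\<mu>) \<in> set ?ts" for X Y \<mu> using that pq(1,2) by auto
      show "\<exists>l\<in>{1..5}. l \<in> X \<or> l \<in> X' \<or> l \<in> Y \<and> l \<in> Y'"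
        if "(X,Y,\<mu>) \<in> set ?ts" "(X',Y',\<mu>') \<in> set ?ts" for X Y \<mu> X' Y' \<mu>'
        using that unfolding five_colours by auto
      show "(\<Sum>(X,Y,\<mu>)\<leftarrow>?ts. \<mu> * ((if l \<in> X then 1 / real a else 0) + (if l \<in> Y then 1 / real (a + b) else 0))) \<le> T"
        if "l \<in> {1..5}" for l
        using that unfolding five_colours by (auto simp: cost)
    qed simp
    then show ?thesis by (simp add: T_def)
  qed
qed

section \<open>The asymptotic value\<close>

lemma asymptotic_form:
  fixes R :: "nat \<Rightarrow> real"
  assumes R0: "R 0 = 0" and up: "\<And>n. R n \<le> t * real n + K"
    and lo: "\<And>e. 0 < e \<Longrightarrow> \<exists>C. \<forall>n. (t - e) * real n - C \<le> R n"
  shows "\<exists>\<epsilon>\<in>o(\<lambda>_::nat. 1::real). \<forall>n. R n = (t + \<epsilon> n) * real n"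
proof (intro bexI[of _ "\<lambda>n. R n / real n - t"] allI)
  show "R n = (t + (R n / real n - t)) * real n" for n using R0 by (cases "n = 0") auto
  show "(\<lambda>n. R n / real n - t) \<in> o(\<lambda>_. 1)"
  proof (rule landau_o.smallI)
    fix c :: real assume c: "0 < c"
    obtain C where C: "\<And>n. (t - c / 2) * real n - C \<le> R n" using lo[of "c / 2"] c by auto
    obtain N where N: "2 * \<bar>C\<bar> / c + \<bar>K\<bar> / c + 1 \<le> real N" using real_arch_simple by blast
    show "\<forall>\<^sub>F n in at_top. norm (R n / real n - t) \<le> c * norm (1::real)"
    proof (rule eventually_sequentiallyI)
      fix n assume "N \<le> n"
      then have n: "2 * \<bar>C\<bar> / c + \<bar>K\<bar> / c + 1 \<le> real n" using N by linarith
      have "0 \<le> \<bar>C\<bar> / c" "0 \<le> \<bar>K\<bar> / c" using c by auto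
      then have "0 < real n" "\<bar>K\<bar> / c \<le> real n" "2 * \<bar>C\<bar> / c \<le> real n" using n by linarith+
      then have n0: "0 < real n" and K: "\<bar>K\<bar> \<le> c * real n" and CC: "2 * \<bar>C\<bar> \<le> c * real n"
        using c by (simp_all add: field_simps)
      have "R n \<le> (t + c) * real n" using up[of n] K by (simp add: algebra_simps)
      then have "R n / real n \<le> t + c" using n0 by (simp add: divide_le_eq)
      moreover have "(t - c) * real n \<le> R n" using C[of n] CC by (simp add: algebra_simps)
      then have "t - c \<le> R n / real n" using n0 by (simp add: le_divide_eq)
      ultimately show "norm (R n / real n - t) \<le> c * norm (1::real)" by (simp add: abs_le_iff)
    qed
  qed
qed

text \<open>
  For \<open>n = 0\<close> the asymptotic form demands the exact value 0.
\<close>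

lemma Rt_five_asymptotics:
  fixes a b :: nat and D t :: real
  assumes ab: "1 \<le> a" "a \<le> b"
    and D: "5*real a+real b \<le> D" "(7*real a+3*real b)/2 \<le> D" "(8*real a+5*real b)/3 \<le> D" "9*(real a+real b)/5 \<le> D"
    and t: "t = 1 / D" and up: "\<And>n. real (Rt 5 (complete_bipartite_graph a b) (complete_graph n)) \<le> t * real n + 10"
  shows "\<exists>\<epsilon>\<in>o(\<lambda>_::nat. 1::real). \<forall>n. real (Rt 5 (complete_bipartite_graph a b) (complete_graph n)) = (t + \<epsilon> n) * real n"
proof (rule asymptotic_form[OF _ up])
  have "real (Rt 5 (complete_bipartite_graph a b) (complete_graph 0)) \<le> 0"
    by (rule Rt_le_cover_cost[OF ab, of 5 "\<lambda>_. {}" 0 "\<lambda>_. {}"]) auto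
  then show "real (Rt 5 (complete_bipartite_graph a b) (complete_graph 0)) = 0" by simp
  show "\<exists>C. \<forall>n. (t - e) * real n - C \<le> real (Rt 5 (complete_bipartite_graph a b) (complete_graph n))" if "0 < e" for e
    unfolding t by (rule Rt_five_lower[OF ab that D])
qed

theorem theorem6p12:
  fixes a b :: nat
  assumes "1 \<le> a" and "a \<le> b"
  shows "(real b \<le> 3 * real a \<longrightarrow>
           (\<exists>\<epsilon> \<in> o(\<lambda>_::nat. 1::real). \<forall>n. real (Rt 5 (complete_bipartite_graph a b) (complete_graph n))
              = (1 / (5 * real a + real b) + \<epsilon> n) * real n)) \<and>
         (3 * real a \<le> real b \<and> real b \<le> 5 * real a \<longrightarrow>
           (\<exists>\<epsilon> \<in> o(\<lambda>_::nat. 1::real). \<forall>n. real (Rt 5 (complete_bipartite_graph a b) (complete_graph n))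
              = (2 / (7 * real a + 3 * real b) + \<epsilon> n) * real n)) \<and>
         (5 * real a \<le> real b \<and> real b \<le> 13 / 2 * real a \<longrightarrow>
           (\<exists>\<epsilon> \<in> o(\<lambda>_::nat. 1::real). \<forall>n. real (Rt 5 (complete_bipartite_graph a b) (complete_graph n))
              = (3 / (8 * real a + 5 * real b) + \<epsilon> n) * real n)) \<and>
         (13 / 2 * real a \<le> real b \<longrightarrow>
           (\<exists>\<epsilon> \<in> o(\<lambda>_::nat. 1::real). \<forall>n. real (Rt 5 (complete_bipartite_graph a b) (complete_graph n))
              = (5 / (9 * (real a + real b)) + \<epsilon> n) * real n))"
proof (intro conjI impI)
  note up = Rt_five_upper[OF assms]
  have pos: "0 < real a" "real a \<le> real b" using assms by auto
  show "\<exists>\<epsilon> \<in> o(\<lambda>_::nat. 1::real). \<forall>n. real (Rt 5 (complete_bipartite_graph a b) (complete_graph n))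
      = (1 / (5 * real a + real b) + \<epsilon> n) * real n" if "real b \<le> 3 * real a"
    by (rule Rt_five_asymptotics[OF assms, where D = "5 * real a + real b"]) (use that pos up(1) in auto)
  show "\<exists>\<epsilon> \<in> o(\<lambda>_::nat. 1::real). \<forall>n. real (Rt 5 (complete_bipartite_graph a b) (complete_graph n))
      = (2 / (7 * real a + 3 * real b) + \<epsilon> n) * real n" if "3 * real a \<le> real b \<and> real b \<le> 5 * real a"
    by (rule Rt_five_asymptotics[OF assms, where D = "(7 * real a + 3 * real b) / 2"]) (use that pos up(2) in auto)
  show "\<exists>\<epsilon> \<in> o(\<lambda>_::nat. 1::real). \<forall>n. real (Rt 5 (complete_bipartite_graph a b) (complete_graph n))
      = (3 / (8 * real a + 5 * real b) + \<epsilon> n) * real n" if "5 * real a \<le> real b \<and> real b \<le> 13 / 2 * real a"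
    by (rule Rt_five_asymptotics[OF assms, where D = "(8 * real a + 5 * real b) / 3"]) (use that pos up(3) in auto)
  show "\<exists>\<epsilon> \<in> o(\<lambda>_::nat. 1::real). \<forall>n. real (Rt 5 (complete_bipartite_graph a b) (complete_graph n))
      = (5 / (9 * (real a + real b)) + \<epsilon> n) * real n" if "13 / 2 * real a \<le> real b"
    by (rule Rt_five_asymptotics[OF assms, where D = "9 * (real a + real b) / 5"]) (use that pos up(4) in auto)
qed

end
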